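(* Let $M\in\mathbb{R}^{m\times n}$ and $1\le s\le\min(m,n)$, partitioned as $M=\begin{bmatrix}A_M & B_M \\ F_M & C_M\end{bmatrix}$ with $A_M\in\mathbb{R}^{s\times s}$. Let $G=\begin{bmatrix}G_A \\ G_B\end{bmatrix}\in\mathbb{R}^{m\times s}$ and $S=\begin{bmatrix}S_A & S_B\end{bmatrix}\in\mathbb{R}^{s\times n}$ with $G_A,S_A\in\mathbb{R}^{s\times s}$, and let $e_s$ satisfy $\|M-GS\|_2\le e_s$. Let $\beta\ge1$ and $\gamma\ge1$ be constants. Assume: 1. $\sigma_s(GS)>0$; 2. $\sigma_s(G)\,\sigma_s(S)=\sigma_s(GS)/\gamma$; 3. $\sigma_s(G_A)\ge\sigma_s(G)/\beta$ and $\sigma_s(S_A)\ge\sigma_s(S)/\beta$; 4. $e_s<(\sigma_s(M)-e_s)/(\beta^2\gamma)$; 5. $\sigma_{s+1}(M)<\dfrac{\sigma_s(M)-e_s}{\beta^2\gamma}-e_s$; 6. $A_M$ and $A_{lg}$ are non-singular, where $A_{lg}$ is the top-left $s\times s$ block of the rank-$s$ truncated SVD $M_{lg}$ of $M$. Then the error $\|M-\hat M\|_2$ of the Nyström approximation $\hat M=\begin{bmatrix}A_M \\ F_M\end{bmatrix}A_M^{-1}\begin{bmatrix}A_M & B_M\end{bmatrix}$ is bounded by $$\frac{\sigma_{s+1}(M)\,\beta^2\gamma}{\sigma_s(M)-(1+\beta^2\gamma)e_s}\left(\frac{\sigma_1(M)^2\,\beta^2\gamma}{\sigma_s(M)-(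1+\beta^2\gamma)e_s-\sigma_{s+1}(M)\beta^2\gamma}+2\sigma_1(M)+\sigma_{s+1}(M)\right).$$
   Context: $\sigma_k(\cdot)$ denotes the $k$-th largest singular value, with $\sigma_{s+1}(M)=0$ if $s=\min(m,n)$, and $\|\cdot\|_2$ is the spectral norm. With an SVD $M=\sum_{i=1}^{\min(m,n)}\sigma_iu_iv_i^T$ ($\sigma_1\ge\sigma_2\ge\cdots$), $M_{lg}=\sum_{i=1}^s\sigma_iu_iv_i^T$. The Nyström approximation leaves $A_M,B_M,F_M$ unchanged and replaces $C_M$ by $F_MA_M^{-1}B_M$. *)

theory Defs
  imports Jordan_Normal_Form.Char_Poly Jordan_Normal_Form.Gauss_Jordan_Elimination
begin

definition vec_2norm :: "real vec \<Rightarrow> real" where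
  "vec_2norm x = sqrt (scalar_prod x x)"

text \<open>The operator norm induced by the Euclidean norms. Taking the supremum over the closed unit
  ball instead of the unit sphere makes no difference, except that the value is 0
  for matrices without columns.\<close>

definition spectral_norm :: "real mat \<Rightarrow> real" where
  "spectral_norm M =
     (SUP x \<in> {x \<in> carrier_vec (dim_col M). vec_2norm x \<le> 1}. vec_2norm (M *\<^sub>v x))"

text \<open>\<open>singular_value M k\<close> is the \<open>k\<close>-th largest singular value, counting from \<open>k = 1\<close>: the square
  root of the \<open>k\<close>-th largest eigenvalue of \<open>M\<^sup>T M\<close>, with multiplicity. There are
  \<open>min m n\<close> singular values, and larger indices give 0.\<close>

definition singular_value :: "real mat \<Rightarrow> nat \<Rightarrow> real" where
  "singular_value M k =
     (if 1 \<le> k \<and> k \<le> min (dim_row M) (dim_col M)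
      then sqrt (rev (sorted_list_of_multiset (proots (char_poly (transpose_mat M * M)))) ! (k - 1))
      else 0)"

definition orthonormal_family :: "nat \<Rightarrow> nat \<Rightarrow> (nat \<Rightarrow> real vec) \<Rightarrow> bool" where
  "orthonormal_family d r u \<longleftrightarrow>
     (\<forall>i\<in>{1..r}. u i \<in> carrier_vec d) \<and>
     (\<forall>i\<in>{1..r}. \<forall>j\<in>{1..r}. scalar_prod (u i) (u j) = (if i = j then 1 else 0))"

text \<open>The partial sum \<open>\<Sum>i=1..r. \<sigma>\<^sub>i u\<^sub>i v\<^sub>i\<^sup>T\<close>, written entrywise.\<close>

definition svd_sum :: "real mat \<Rightarrow> (nat \<Rightarrow> real vec) \<Rightarrow> (nat \<Rightarrow> real vec) \<Rightarrow> nat \<Rightarrow> real mat" where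
  "svd_sum M u v r =
     mat (dim_row M) (dim_col M)
       (\<lambda>(a, b). \<Sum>i = 1..r. singular_value M i * vec_index (u i) a * vec_index (v i) b)"

text \<open>The (thin) singular value decomposition with left singular vectors \<open>u 1, u 2, \<dots>\<close> and right
  singular vectors \<open>v 1, v 2, \<dots>\<close>.\<close>

definition is_svd :: "real mat \<Rightarrow> (nat \<Rightarrow> real vec) \<Rightarrow> (nat \<Rightarrow> real vec) \<Rightarrow> bool" where
  "is_svd M u v \<longleftrightarrow>
     (let r = min (dim_row M) (dim_col M) in
        orthonormal_family (dim_row M) r u \<and> orthonormal_family (dim_col M) r v \<and>
        M = svd_sum M u v r)"

text \<open>The column analogue of \<^const>\<open>append_rows\<close>.\<close>

definition append_cols :: "'a :: zero mat \<Rightarrow> 'a mat \<Rightarrow> 'a mat" where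
  "append_cols A B = four_block_mat A B (0\<^sub>m 0 (dim_col A)) (0\<^sub>m 0 (dim_col B))"

text \<open>Meaningful only for non-singular \<open>A\<close>, since \<^const>\<open>mat_inverse\<close> returns an option.\<close>

definition nystrom :: "real mat \<Rightarrow> real mat \<Rightarrow> real mat \<Rightarrow> real mat" where
  "nystrom A B F = append_rows A F * the (mat_inverse A) * append_cols A B"

end

theory Submission
  imports Defs Jordan_Normal_Form.Schur_Decomposition "HOL-Analysis.L2_Norm"
begin

text \<open>
  Write \<open>K = \<beta>\<^sup>2 \<gamma>\<close> and \<open>t = \<sigma>\<^sub>s\<^sub>+\<^sub>1(M)\<close>. The factorization \<open>GS\<close> and Weyl's inequality
  give \<open>\<bar>A x\<bar> \<ge> d \<bar>x\<bar>\<close> with \<open>d = (\<sigma>\<^sub>s(M) - e\<^sub>s) / K - e\<^sub>s\<close>, hence \<open>\<bar>A\<^sub>l\<^sub>g x\<bar> \<ge> d' \<bar>x\<bar>\<close> with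
  \<open>d' = d - t > 0\<close>. The residual of the approximation only depends on the lower part \<open>y\<close> of its
  argument, so the upper part may be chosen such that \<open>z = (x, y)\<close> is in the kernel of \<open>M\<^sub>l\<^sub>g\<close>; then
  \<open>d' \<bar>z\<bar> \<le> \<sigma>\<^sub>1 \<bar>y\<bar>\<close> and \<open>\<bar>M z\<bar> \<le> t \<bar>z\<bar>\<close>. With \<open>M z = (f, g)\<close> and \<open>A w = f\<close> the residual is
  \<open>(0, g - F w)\<close>, of norm at most \<open>\<sigma>\<^sub>1 \<bar>M z\<bar> / d\<close>. Altogether the error is at most
  \<open>\<sigma>\<^sub>1\<^sup>2 t / (d d')\<close>, which is stronger than the claim.
\<close>

section \<open>Diagonalization of real symmetric matrices\<close>

text \<open>Extend \<open>v\<close> to a basis and apply Gram-Schmidt, which keeps the first vector.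
  The normalized results are the columns of \<open>W\<close>, so \<open>c\<close> is the reciprocal
  of the norm of \<open>v\<close>.\<close>

lemma orthogonal_matrix_with_first_column:
  fixes v :: "real vec"
  assumes v: "v \<in> carrier_vec n" and v0: "v \<noteq> 0\<^sub>v n"
  obtains W c where "W \<in> carrier_mat n n" "W\<^sup>T * W = 1\<^sub>m n" "W * W\<^sup>T = 1\<^sub>m n" "n > 0"
    "col W 0 = c \<cdot>\<^sub>v v"
proof -
  interpret cof_vec_space n "TYPE(real)" .
  define b where "b = basis_completion v"
  define ws where "ws = gram_schmidt n b"
  from basis_completion[OF v v0, folded b_def]
  have dist_b: "distinct b" and indep: "\<not> lin_dep (set b)" and b: "set b \<subseteq> carrier_vec n"
    and hdb: "hd b = v" and len_b: "length b = n" by auto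
  have n: "n > 0"
  proof (rule ccontr)
    assume "\<not> n > 0"
    then have "v = 0\<^sub>v n" using v by auto
    then show False using v0 by simp
  qed
  from hdb len_b n obtain vs where bv: "b = v # vs" by (cases b, auto)
  from gram_schmidt_result[OF b dist_b indep refl, folded ws_def]
  have ws: "set ws \<subseteq> carrier_vec n" "corthogonal ws" "length ws = n" by (auto simp: len_b)
  have hdws: "hd ws = v" using gram_schmidt_hd[OF v, of vs, folded bv] unfolding ws_def .
  have wsc: "ws ! i \<in> carrier_vec n" if "i < n" for i using ws that by (auto simp: subset_iff)
  \<comment> \<open>Conjugation is the identity on the reals. The equivalence also covers
    \<open>i = j\<close>, where it says that no vector of the family is null; this yields
    \<open>pos\<close>.\<close>
  have orth: "ws ! i \<bullet> ws ! j = 0 \<longleftrightarrow> i \<noteq> j" if "i < n" "j < n" for i j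
    using corthogonalD[OF ws(2), of i j] that ws(3)
    by (simp add: conjugate_vec_def scalar_prod_def)
  have pos: "ws ! i \<bullet> ws ! i > 0" if "i < n" for i
    using orth[OF that that] by (auto simp: scalar_prod_def less_le intro!: sum_nonneg)
  define W where "W = mat_of_cols n (map (\<lambda>w. (1 / sqrt (w \<bullet> w)) \<cdot>\<^sub>v w) ws)"
  have W: "W \<in> carrier_mat n n" unfolding W_def using ws by (auto simp: mat_of_cols_def)
  have colW: "col W i = (1 / sqrt (ws ! i \<bullet> ws ! i)) \<cdot>\<^sub>v ws ! i" if "i < n" for i
    unfolding W_def using that ws(3) wsc[OF that] by (subst col_mat_of_cols) auto
  have "W\<^sup>T * W = 1\<^sub>m n"
  proof (rule eq_matI)
    fix i j assume "i < dim_row (1\<^sub>m n :: real mat)" "j < dim_col (1\<^sub>m n :: real mat)"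
    then have ij: "i < n" "j < n" by auto
    have "(W\<^sup>T * W) $$ (i, j) = col W i \<bullet> col W j" using ij W by simp
    also have "\<dots> = 1 / sqrt (ws ! i \<bullet> ws ! i) * (1 / sqrt (ws ! j \<bullet> ws ! j)) * (ws ! i \<bullet> ws ! j)"
      using carrier_vecD[OF wsc[OF ij(1)]] carrier_vecD[OF wsc[OF ij(2)]] by (simp add: colW ij)
    also have "\<dots> = 1\<^sub>m n $$ (i, j)" using ij orth[OF ij] pos[OF ij(1)] by (auto simp: field_simps)
    finally show "(W\<^sup>T * W) $$ (i, j) = 1\<^sub>m n $$ (i, j)" .
  qed (use W in auto)
  moreover have "W * W\<^sup>T = 1\<^sub>m n" using mat_mult_left_right_inverse[OF _ W calculation] W by auto
  moreover have "ws ! 0 = v" using hdws ws(3) n by (cases ws) auto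
  ultimately show thesis using that[OF W] colW[OF n] n by auto
qed

text \<open>Deflation: conjugating by an orthogonal matrix whose first column is an eigenvector
  splits off a 1x1 block.\<close>

lemma symmetric_diagonalization:
  fixes A :: "real mat"
  assumes "A \<in> carrier_mat n n" and "A\<^sup>T = A" and "char_poly A = (\<Prod>e\<leftarrow>es. [:- e, 1:])"
  shows "\<exists>P \<in> carrier_mat n n. P\<^sup>T * P = 1\<^sub>m n \<and> P\<^sup>T * A * P = mat_diag n (\<lambda>i. es ! i)"
  using assms
proof (induction es arbitrary: n A)
  case Nil
  with degree_monic_char_poly[of A n] have "n = 0" by auto
  then show ?case using Nil by (intro bexI[of _ A]) (auto simp: mat_diag_def)
next
  case (Cons e es)
  note A = Cons.prems(1) and sym = Cons.prems(2)
  define k where "k = n - 1"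
  have cp: "char_poly A = [:- e, 1:] * (\<Prod>e\<leftarrow>es. [:- e, 1:])" using Cons.prems(3) by simp
  have "eigenvalue A e" unfolding eigenvalue_root_char_poly[OF A] cp by simp
  then obtain v where v: "v \<in> carrier_vec n" "v \<noteq> 0\<^sub>v n" "A *\<^sub>v v = e \<cdot>\<^sub>v v"
    unfolding eigenvalue_def eigenvector_def using A by auto
  obtain W c where W: "W \<in> carrier_mat n n" and WW: "W\<^sup>T * W = 1\<^sub>m n" "W * W\<^sup>T = 1\<^sub>m n"
    and n: "n > 0" and colW: "col W 0 = c \<cdot>\<^sub>v v"
    by (rule orthogonal_matrix_with_first_column[OF v(1,2)])
  have nk: "n = 1 + k" using n by (simp add: k_def)
  define A' where "A' = W\<^sup>T * A * W"
  have A': "A' \<in> carrier_mat n n" using W A by (auto simp: A'_def)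
  have sym': "A'\<^sup>T = A'"
    using W A sym by (simp add: A'_def transpose_mult[of _ n n _ n] assoc_mult_mat[of _ n n _ n _ n])
  have "similar_mat_wit A' A (W\<^sup>T) W"
    using WW W A A' by (intro similar_mat_witI[of _ _ n]) (auto simp: A'_def)
  then have sim: "char_poly A' = char_poly A" by (intro char_poly_similar) (auto simp: similar_mat_def)
  have Acol: "A *\<^sub>v col W 0 = e \<cdot>\<^sub>v col W 0"
    unfolding colW using v A by (simp add: mult_mat_vec smult_smult_assoc mult.commute)
  \<comment> \<open>The first column of \<open>W\<close> is an eigenvector and all columns are
    orthonormal, so \<open>A'\<close> maps the first unit vector to its \<open>e\<close>-fold;
    symmetry transfers this to the first row.\<close>
  have col0: "A' $$ (i, 0) = (if i = 0 then e else 0)" if "i < n" for i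
  proof -
    have "A' $$ (i, 0) = col W i \<bullet> (A *\<^sub>v col W 0)"
      using that n W A unfolding A'_def assoc_mult_mat[OF transpose_carrier_mat[THEN iffD2, OF W] A W]
      by (simp add: mult_mat_vec_def)
    also have "\<dots> = e * (W\<^sup>T * W) $$ (i, 0)" unfolding Acol using that n W by simp
    finally show ?thesis using WW that n by simp
  qed
  have row0: "A' $$ (0, i) = (if i = 0 then e else 0)" if "i < n" for i
    using col0[OF that] that n A' arg_cong[OF sym', of "\<lambda>X. X $$ (0, i)"] by simp
  define A3 where "A3 = mat k k (\<lambda>(i, j). A' $$ (Suc i, Suc j))"
  have A3: "A3 \<in> carrier_mat k k" by (simp add: A3_def)
  let ?E = "mat 1 1 (\<lambda>_. e)"
  have block: "A' = four_block_mat ?E (0\<^sub>m 1 k) (0\<^sub>m k 1) A3"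
    using A' nk col0 row0 by (intro eq_matI) (auto simp: A3_def)
  \<comment> \<open>Similarity preserves the characteristic polynomial and the block form factors
    it; cancelling \<open>[:- e, 1:]\<close> leaves the list \<open>es\<close> for the smaller
    block.\<close>
  have "char_poly A' = char_poly ?E * char_poly A3"
    unfolding block by (rule char_poly_four_block_zeros_col) (use A3 in auto)
  also have "char_poly ?E = [:- e, 1:]" by (simp add: char_poly_defs det_def sign_def)
  finally have cp3: "char_poly A3 = (\<Prod>e\<leftarrow>es. [:- e, 1:])"
    unfolding sim cp by (metis mult_cancel_left pCons_eq_0_iff zero_neq_one)
  have sym3: "A3\<^sup>T = A3"
  proof (rule eq_matI)
    fix i j assume "i < dim_row A3" "j < dim_col A3"
    then have ij: "i < k" "j < k" using A3 by auto
    have "A'\<^sup>T $$ (Suc i, Suc j) = A' $$ (Suc j, Suc i)" using ij A' nk by simp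
    then show "A3\<^sup>T $$ (i, j) = A3 $$ (i, j)" using ij by (simp add: sym' A3_def)
  qed (use A3 in auto)
  from Cons.IH[OF A3 sym3 cp3] obtain P where P: "P \<in> carrier_mat k k"
    and PP: "P\<^sup>T * P = 1\<^sub>m k" and PAP: "P\<^sup>T * A3 * P = mat_diag k (\<lambda>i. es ! i)" by auto
  \<comment> \<open>The 1x1 block is diagonal already, so the matrix for \<open>A3\<close> is
    extended by an identity block; \<open>W * P'\<close> then diagonalizes \<open>A\<close>.\<close>
  define P' where "P' = four_block_mat (1\<^sub>m 1) (0\<^sub>m 1 k) (0\<^sub>m k 1) P"
  have P': "P' \<in> carrier_mat n n" 
    using four_block_carrier_mat[OF one_carrier_mat P] unfolding P'_def nk .
  have P'T: "P'\<^sup>T = four_block_mat (1\<^sub>m 1) (0\<^sub>m 1 k) (0\<^sub>m k 1) (P\<^sup>T)"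
    unfolding P'_def using P by (subst transpose_four_block_mat[of _ 1 1 _ k _ k]) auto
  have P'P': "P'\<^sup>T * P' = 1\<^sub>m n"
    unfolding P'T unfolding P'_def nk using P PP
    by (subst mult_four_block_mat[of _ 1 1 _ k _ k _ _ 1 _ k]) (auto intro!: eq_matI)
  have "P'\<^sup>T * A' = four_block_mat ?E (0\<^sub>m 1 k) (0\<^sub>m k 1) (P\<^sup>T * A3)"
    unfolding P'T block using P A3
    by (subst mult_four_block_mat[of _ 1 1 _ k _ k _ _ 1 _ k]) auto
  then have "P'\<^sup>T * A' * P' = four_block_mat ?E (0\<^sub>m 1 k) (0\<^sub>m k 1) (P\<^sup>T * A3 * P)"
    unfolding P'_def using P A3
    by (simp, subst mult_four_block_mat[of _ 1 1 _ k _ k _ _ 1 _ k]) auto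
  also have "\<dots> = mat_diag n (\<lambda>i. (e # es) ! i)"
    unfolding PAP nk by (intro eq_matI) (auto simp: mat_diag_def)
  finally have D: "P'\<^sup>T * A' * P' = mat_diag n (\<lambda>i. (e # es) ! i)" .
  define Q where "Q = W * P'"
  have Q: "Q \<in> carrier_mat n n" using W P' by (simp add: Q_def)
  have QT: "Q\<^sup>T = P'\<^sup>T * W\<^sup>T" unfolding Q_def using W P' by (simp add: transpose_mult[of _ n n _ n])
  have "Q\<^sup>T * Q = P'\<^sup>T * (W\<^sup>T * W * P')"
    unfolding QT unfolding Q_def using W P' by (simp add: assoc_mult_mat[of _ n n _ n _ n])
  also have "\<dots> = 1\<^sub>m n" unfolding WW using P' P'P' by simp
  finally have "Q\<^sup>T * Q = 1\<^sub>m n" .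
  moreover have "Q\<^sup>T * A * Q = P'\<^sup>T * A' * P'"
    unfolding QT unfolding Q_def A'_def using W P' A
    by (simp add: assoc_mult_mat[of _ n n _ n _ n])
  ultimately show ?case using Q D by auto
qed

text \<open>Over the complex numbers the polynomial splits. As a Hermitian matrix has only real
  eigenvalues, the factorization can be pulled back along the injective embedding of the
  reals.\<close>

lemma symmetric_char_poly_splits:
  fixes A :: "real mat"
  assumes A: "A \<in> carrier_mat n n" and sym: "A\<^sup>T = A"
  shows "\<exists>es. char_poly A = (\<Prod>e\<leftarrow>es. [:- e, 1:])"
proof -
  let ?C = "map_mat complex_of_real A"
  have C: "?C \<in> carrier_mat n n" using A by simp
  from char_poly_factorized[OF C] obtain as where as: "char_poly ?C = (\<Prod>a\<leftarrow>as. [:- a, 1:])" by auto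
  have real: "complex_of_real (Re a) = a" if "a \<in> set as" for a
  proof -
    have "poly (char_poly ?C) a = 0" unfolding as using that by (rule linear_poly_root)
    then have "eigenvalue ?C a" unfolding eigenvalue_root_char_poly[OF C] .
    then obtain x where x: "x \<in> carrier_vec n" "x \<noteq> 0\<^sub>v n" "?C *\<^sub>v x = a \<cdot>\<^sub>v x"
      unfolding eigenvalue_def eigenvector_def using A by auto
    have cx: "conjugate x \<in> carrier_vec n" using x by simp
    have symC: "?C\<^sup>T = ?C" using sym by (metis map_mat_transpose)
    have cCx: "?C *\<^sub>v conjugate x = conjugate (?C *\<^sub>v x)"
      using A x(1) by (intro eq_vecI) (auto simp: scalar_prod_def conjugate_complex_def cnj_sum)
    \<comment> \<open>Moving the symmetric matrix to the other side of the pairing of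
      \<open>x\<close> with its conjugate turns \<open>a\<close> into \<open>cnj a\<close>, and this
      pairing is non-zero.\<close>
    have "a * (x \<bullet> conjugate x) = (?C *\<^sub>v x) \<bullet> conjugate x" unfolding x(3) using x by simp
    also have "\<dots> = x \<bullet> (?C *\<^sub>v conjugate x)"
      using transpose_vec_mult_scalar[OF C cx x(1)] unfolding symC .
    also have "\<dots> = cnj a * (x \<bullet> conjugate x)" unfolding cCx x(3) using x
      by (simp add: scalar_prod_def sum_distrib_left conjugate_complex_def ac_simps)
    finally have "a * (x \<bullet>c x) = cnj a * (x \<bullet>c x)" .
    moreover have "x \<bullet>c x \<noteq> 0" using conjugate_square_eq_0_vec[OF x(1)] x(2) by simp
    ultimately have "cnj a = a" by simp
    then show ?thesis by (metis Reals_cnj_iff of_real_Re)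
  qed
  define es where "es = map Re as"
  have as_es: "as = map complex_of_real es" unfolding es_def using real by (simp add: map_idI)
  have "map_poly complex_of_real (char_poly A) = char_poly ?C"
    by (rule of_real_hom.char_poly_hom[OF A, symmetric])
  also have "\<dots> = map_poly complex_of_real (\<Prod>e\<leftarrow>es. [:- e, 1:])"
    unfolding as as_es
  proof (induction es)
    case (Cons a l)
    interpret M: map_poly_comm_ring_hom complex_of_real ..
    have "map_poly complex_of_real ([:- a, 1:] * (\<Prod>e\<leftarrow>l. [:- e, 1:]))
      = [:- complex_of_real a, 1:] * map_poly complex_of_real (\<Prod>e\<leftarrow>l. [:- e, 1:])"
      unfolding M.hom_mult by simp
    then show ?case using Cons by (simp only: list.map prod_list.Cons)
  qed simp
  finally have "char_poly A = (\<Prod>e\<leftarrow>es. [:- e, 1:])"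
    by (metis (no_types, lifting) of_real_eq_iff coeff_map_poly of_real_0 poly_eqI)
  then show ?thesis ..
qed

section \<open>Euclidean and spectral norms\<close>

lemma vec_2norm_nonneg [simp]: "vec_2norm x \<ge> 0"
  by (auto simp: vec_2norm_def scalar_prod_def intro!: sum_nonneg)

lemma vec_2norm_sq: "(vec_2norm x)\<^sup>2 = x \<bullet> x"
  unfolding vec_2norm_def
  by (intro real_sqrt_pow2) (auto simp: scalar_prod_def intro!: sum_nonneg)

lemma vec_2norm_L2_set: "vec_2norm x = L2_set (\<lambda>i. x $ i) {0..<dim_vec x}"
  by (simp add: vec_2norm_def scalar_prod_def L2_set_def power2_eq_square)

lemma vec_2norm_triangle:
  assumes "x \<in> carrier_vec n" "y \<in> carrier_vec n"
  shows "vec_2norm (x + y) \<le> vec_2norm x + vec_2norm y"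
proof -
  have "vec_2norm (x + y) = L2_set (\<lambda>i. x $ i + y $ i) {0..<n}"
    using assms by (auto simp: vec_2norm_L2_set intro!: L2_set_cong)
  then show ?thesis
    using L2_set_triangle_ineq[of "\<lambda>i. x $ i" "\<lambda>i. y $ i" "{0..<n}"] assms
    by (simp add: vec_2norm_L2_set)
qed

lemma vec_2norm_smult: "vec_2norm (c \<cdot>\<^sub>v x) = \<bar>c\<bar> * vec_2norm x"
  by (simp add: vec_2norm_def real_sqrt_mult flip: mult.assoc)

lemma vec_2norm_uminus: "vec_2norm (- x) = vec_2norm x"
  by (simp add: vec_2norm_def scalar_prod_def)

lemma vec_2norm_diff_triangle:
  assumes "x \<in> carrier_vec n" "y \<in> carrier_vec n"
  shows "vec_2norm (x - y) \<le> vec_2norm x + vec_2norm y"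
  using vec_2norm_triangle[of x n "- y"] assms minus_add_uminus_vec[of x n y]
  by (simp add: vec_2norm_uminus)

lemma vec_2norm_le_plus_diff:
  assumes "x \<in> carrier_vec n" "y \<in> carrier_vec n"
  shows "vec_2norm x \<le> vec_2norm y + vec_2norm (x - y)"
proof -
  have "x = y + (x - y)" using assms by (intro eq_vecI) auto
  then show ?thesis using vec_2norm_triangle[of y n "x - y"] assms by simp
qed

lemma vec_2norm_eq_0_iff: "vec_2norm x = 0 \<longleftrightarrow> x = 0\<^sub>v (dim_vec x)"
proof -
  have "vec_2norm x = 0 \<longleftrightarrow> (\<forall>i\<in>{0..<dim_vec x}. x $ i = 0)"
    unfolding vec_2norm_L2_set by (rule L2_set_eq_0_iff) simp
  also have "\<dots> \<longleftrightarrow> x = 0\<^sub>v (dim_vec x)"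
  proof
    assume h: "x = 0\<^sub>v (dim_vec x)"
    have "x $ i = 0" if "i < dim_vec x" for i using arg_cong[OF h, of "\<lambda>v. v $ i"] that by simp
    then show "\<forall>i\<in>{0..<dim_vec x}. x $ i = 0" by simp
  qed (auto intro!: eq_vecI)
  finally show ?thesis .
qed

lemma vec_2norm_append_sq: "(vec_2norm (x @\<^sub>v y))\<^sup>2 = (vec_2norm x)\<^sup>2 + (vec_2norm y)\<^sup>2"
  unfolding vec_2norm_sq
  by (rule scalar_prod_append[of _ "dim_vec x" _ "dim_vec y"]) auto

lemma vec_2norm_append_le:
  "vec_2norm x \<le> vec_2norm (x @\<^sub>v y)" "vec_2norm y \<le> vec_2norm (x @\<^sub>v y)"
  by (rule power2_le_imp_le; simp add: vec_2norm_append_sq)+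

lemma spectral_norm_le:
  assumes "\<And>x. x \<in> carrier_vec (dim_col M) \<Longrightarrow> vec_2norm (M *\<^sub>v x) \<le> c * vec_2norm x" and "c \<ge> 0"
  shows "spectral_norm M \<le> c"
  unfolding spectral_norm_def
proof (rule cSUP_least)
  have "0\<^sub>v (dim_col M) \<in> {x \<in> carrier_vec (dim_col M). vec_2norm x \<le> 1}"
    by (auto simp: vec_2norm_def)
  then show "{x \<in> carrier_vec (dim_col M). vec_2norm x \<le> 1} \<noteq> {}" by blast
next
  fix x assume x: "x \<in> {x \<in> carrier_vec (dim_col M). vec_2norm x \<le> 1}"
  then have "vec_2norm (M *\<^sub>v x) \<le> c * vec_2norm x" using assms(1) by simp
  also have "\<dots> \<le> c * 1" using x assms(2) by (intro mult_left_mono) auto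
  finally show "vec_2norm (M *\<^sub>v x) \<le> c" by simp
qed

text \<open>The supremum dominates its members only if they are bounded above; the bound with some
  constant \<open>c\<close> ensures this. The rest is normalization of \<open>x\<close>.\<close>

lemma le_spectral_norm:
  assumes M: "M \<in> carrier_mat m n" and x: "x \<in> carrier_vec n"
    and bound: "\<And>x. x \<in> carrier_vec n \<Longrightarrow> vec_2norm (M *\<^sub>v x) \<le> c * vec_2norm x" and "c \<ge> 0"
  shows "vec_2norm (M *\<^sub>v x) \<le> spectral_norm M * vec_2norm x"
proof (cases "vec_2norm x = 0")
  case True
  then show ?thesis using bound[OF x] by simp
next
  case False
  then have pos: "vec_2norm x > 0" using vec_2norm_nonneg[of x] by linarith
  let ?U = "{x \<in> carrier_vec (dim_col M). vec_2norm x \<le> 1}"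
  define y where "y = (1 / vec_2norm x) \<cdot>\<^sub>v x"
  have y: "y \<in> ?U" using x M pos by (simp add: y_def vec_2norm_smult)
  have "bdd_above ((\<lambda>x. vec_2norm (M *\<^sub>v x)) ` ?U)"
  proof (rule bdd_aboveI2)
    fix z assume z: "z \<in> ?U"
    then have "vec_2norm (M *\<^sub>v z) \<le> c * vec_2norm z" using bound M by simp
    also have "\<dots> \<le> c * 1" using z \<open>c \<ge> 0\<close> by (intro mult_left_mono) auto
    finally show "vec_2norm (M *\<^sub>v z) \<le> c" by simp
  qed
  then have "vec_2norm (M *\<^sub>v y) \<le> spectral_norm M"
    unfolding spectral_norm_def using y by (rule cSUP_upper2) simp
  moreover have "vec_2norm (M *\<^sub>v y) = vec_2norm (M *\<^sub>v x) / vec_2norm x"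
    unfolding y_def using mult_mat_vec[OF M x] pos by (simp add: vec_2norm_smult)
  ultimately show ?thesis using pos by (simp add: field_simps)
qed

section \<open>Singular values\<close>

text \<open>The vectors \<open>w i\<close> are right singular vectors and the \<open>l i\<close> are the eigenvalues of
  \<open>X\<^sup>T X\<close>; indices start at 0 here, but at 1 in \<^const>\<open>singular_value\<close>.\<close>

definition right_singular_basis :: "real mat \<Rightarrow> (nat \<Rightarrow> real vec) \<Rightarrow> (nat \<Rightarrow> real) \<Rightarrow> bool" where
  "right_singular_basis X w l \<longleftrightarrow> (let n = dim_col X in
     (\<forall>i<n. w i \<in> carrier_vec n) \<and> (\<forall>i<n. l i \<ge> 0) \<and> (\<forall>i j. i \<le> j \<longrightarrow> j < n \<longrightarrow> l j \<le> l i) \<and>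
     (\<forall>x\<in>carrier_vec n. (vec_2norm x)\<^sup>2 = (\<Sum>i<n. (w i \<bullet> x)\<^sup>2)) \<and>
     (\<forall>x\<in>carrier_vec n. (vec_2norm (X *\<^sub>v x))\<^sup>2 = (\<Sum>i<n. l i * (w i \<bullet> x)\<^sup>2)) \<and>
     (\<forall>k. 1 \<le> k \<longrightarrow> k \<le> min (dim_row X) n \<longrightarrow> singular_value X k = sqrt (l (k - 1))))"

lemma right_singular_basisD:
  assumes "X \<in> carrier_mat m n" "right_singular_basis X w l"
  shows "\<And>i. i < n \<Longrightarrow> w i \<in> carrier_vec n"
    and "\<And>i. i < n \<Longrightarrow> l i \<ge> 0"
    and "\<And>i j. i \<le> j \<Longrightarrow> j < n \<Longrightarrow> l j \<le> l i"
    and "\<And>x. x \<in> carrier_vec n \<Longrightarrow> (vec_2norm x)\<^sup>2 = (\<Sum>i<n. (w i \<bullet> x)\<^sup>2)"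
    and "\<And>x. x \<in> carrier_vec n \<Longrightarrow> (vec_2norm (X *\<^sub>v x))\<^sup>2 = (\<Sum>i<n. l i * (w i \<bullet> x)\<^sup>2)"
    and "\<And>k. 1 \<le> k \<Longrightarrow> k \<le> min m n \<Longrightarrow> singular_value X k = sqrt (l (k - 1))"
  using assms unfolding right_singular_basis_def Let_def by simp_all

text \<open>The columns of an orthogonal matrix diagonalizing \<open>X\<^sup>T * X\<close> serve as
  \<open>w\<close>, with the eigenvalues in the order in which \<open>singular_value\<close> reads
  them.\<close>

lemma right_singular_basis_exists:
  fixes X :: "real mat"
  obtains w l where "right_singular_basis X w l"
proof -
  define m where "m = dim_row X"
  define n where "n = dim_col X"
  have X: "X \<in> carrier_mat m n" by (simp add: m_def n_def)
  define A where "A = X\<^sup>T * X"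
  have A: "A \<in> carrier_mat n n" using X by (simp add: A_def)
  have sym: "A\<^sup>T = A" unfolding A_def using X by (simp add: transpose_mult[of _ n m _ n])
  obtain rs where rs: "char_poly A = (\<Prod>e\<leftarrow>rs. [:- e, 1:])"
    using symmetric_char_poly_splits[OF A sym] by auto
  define es where "es = rev (sorted_list_of_multiset (proots (char_poly A)))"
  \<comment> \<open>The multiset of roots of a product of linear factors is that of the list. Hence
    \<open>es\<close> is a rearrangement of \<open>rs\<close>, and the factorization also holds
    along the decreasing list \<open>es\<close>.\<close>
  have "proots (\<Prod>e\<leftarrow>rs. [:- e, 1:]) = mset rs" for rs :: "real list"
  proof (induction rs)
    case (Cons a rs)
    have "(\<Prod>e\<leftarrow>rs. [:- e, 1:]) \<noteq> 0" by (auto simp: prod_list_zero_iff)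
    then have "proots ([:- a, 1:] * (\<Prod>e\<leftarrow>rs. [:- e, 1:])) = add_mset a (mset rs)"
      using Cons by (subst proots_mult) auto
    then show ?case by (simp only: list.map prod_list.Cons mset.simps)
  qed simp
  then have mset: "mset es = mset rs" by (simp add: es_def rs)
  then have cp: "char_poly A = (\<Prod>e\<leftarrow>es. [:- e, 1:])"
    unfolding rs by (simp flip: prod_mset_prod_list)
  have len: "length es = n"
  proof -
    have "degree (\<Prod>e\<leftarrow>es. [:- e, 1:]) = length es" by (rule degree_linear_factors)
    then show ?thesis using degree_monic_char_poly[OF A] cp by simp
  qed
  obtain P where P: "P \<in> carrier_mat n n" and PP: "P\<^sup>T * P = 1\<^sub>m n"
    and D: "P\<^sup>T * A * P = mat_diag n (\<lambda>i. es ! i)"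
    using symmetric_diagonalization[OF A sym cp] by auto
  have PP': "P * P\<^sup>T = 1\<^sub>m n" using mat_mult_left_right_inverse[OF _ P PP] P by simp
  define w where "w i = col P i" for i
  have w: "w i \<in> carrier_vec n" for i using P by (auto simp: w_def)
  have coord: "P\<^sup>T *\<^sub>v x = vec n (\<lambda>i. w i \<bullet> x)" for x using P by (auto simp: w_def intro!: eq_vecI)
  have expand: "P *\<^sub>v (P\<^sup>T *\<^sub>v x) = x" if "x \<in> carrier_vec n" for x
    using P that PP' assoc_mult_mat_vec[of P n n "P\<^sup>T" n x] by simp
  have norm: "(vec_2norm x)\<^sup>2 = (\<Sum>i<n. (w i \<bullet> x)\<^sup>2)" if x: "x \<in> carrier_vec n" for x
  proof -
    have "(vec_2norm x)\<^sup>2 = x \<bullet> (P *\<^sub>v (P\<^sup>T *\<^sub>v x))" unfolding expand[OF x] by (rule vec_2norm_sq)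
    also have "\<dots> = (P\<^sup>T *\<^sub>v x) \<bullet> (P\<^sup>T *\<^sub>v x)"
      using transpose_vec_mult_scalar[OF P _ x, of "P\<^sup>T *\<^sub>v x"] P x by simp
    finally show ?thesis
      unfolding coord by (simp add: scalar_prod_def[of _ "vec n _"] power2_eq_square lessThan_atLeast0)
  qed
  \<comment> \<open>The quadratic form of \<open>A\<close> at \<open>x\<close> becomes diagonal in
    the coordinates \<open>P\<^sup>T *\<^sub>v x\<close>, whose entries are
    \<open>w i \<bullet> x\<close>.\<close>
  have image: "(vec_2norm (X *\<^sub>v x))\<^sup>2 = (\<Sum>i<n. es ! i * (w i \<bullet> x)\<^sup>2)"
    if x: "x \<in> carrier_vec n" for x
  proof -
    let ?c = "P\<^sup>T *\<^sub>v x"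
    have c: "?c \<in> carrier_vec n" using P x by simp
    have "(vec_2norm (X *\<^sub>v x))\<^sup>2 = x \<bullet> (X\<^sup>T *\<^sub>v (X *\<^sub>v x))"
      using transpose_vec_mult_scalar[of "X" m n x "X *\<^sub>v x"] X x
        comm_scalar_prod[of x n "X\<^sup>T *\<^sub>v (X *\<^sub>v x)"]
      by (simp add: vec_2norm_sq)
    also have "X\<^sup>T *\<^sub>v (X *\<^sub>v x) = A *\<^sub>v x"
      unfolding A_def using X x by (intro assoc_mult_mat_vec[symmetric]) auto
    also have "x \<bullet> (A *\<^sub>v x) = (P *\<^sub>v ?c) \<bullet> (A *\<^sub>v (P *\<^sub>v ?c))" unfolding expand[OF x] ..
    also have "\<dots> = (P\<^sup>T *\<^sub>v (A *\<^sub>v (P *\<^sub>v ?c))) \<bullet> ?c"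
      using transpose_vec_mult_scalar[OF P c, of "A *\<^sub>v (P *\<^sub>v ?c)"] A P c
        comm_scalar_prod[of "P *\<^sub>v ?c" n "A *\<^sub>v (P *\<^sub>v ?c)"] by simp
    also have "P\<^sup>T *\<^sub>v (A *\<^sub>v (P *\<^sub>v ?c)) = (P\<^sup>T * A * P) *\<^sub>v ?c"
      using A P c by (simp add: assoc_mult_mat_vec[of _ n n _ n])
    also have "\<dots> = vec n (\<lambda>i. es ! i * (w i \<bullet> x))"
    proof (rule eq_vecI)
      fix i assume "i < dim_vec (vec n (\<lambda>i. es ! i * (w i \<bullet> x)))"
      then have i: "i < n" by simp
      have "(mat_diag n (\<lambda>i. es ! i) *\<^sub>v ?c) $ i
          = (\<Sum>j = 0..<n. (if i = j then es ! j else 0) * (w j \<bullet> x))"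
        using i by (simp add: mat_diag_def coord scalar_prod_def)
      also have "\<dots> = (\<Sum>j = 0..<n. if j = i then es ! j * (w j \<bullet> x) else 0)"
        by (intro sum.cong) auto
      finally show "((P\<^sup>T * A * P) *\<^sub>v ?c) $ i = vec n (\<lambda>i. es ! i * (w i \<bullet> x)) $ i"
        unfolding D using i by simp
    qed (simp add: D mat_diag_def)
    also have "vec n (\<lambda>i. es ! i * (w i \<bullet> x)) \<bullet> ?c = (\<Sum>i<n. es ! i * (w i \<bullet> x)\<^sup>2)"
      unfolding coord
      by (simp add: scalar_prod_def[of _ "vec n _"] power2_eq_square lessThan_atLeast0 mult.assoc)
    finally show ?thesis .
  qed
  \<comment> \<open>Evaluating \<open>image\<close> at \<open>w i\<close> itself shows that
    \<open>es ! i\<close> is a squared norm.\<close>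
  have nonneg: "es ! i \<ge> 0" if i: "i < n" for i
  proof -
    have "w j \<bullet> w i = (P\<^sup>T * P) $$ (j, i)" if "j < n" for j using that i P by (simp add: w_def)
    then have "w j \<bullet> w i = (if j = i then 1 else 0)" if "j < n" for j using that i PP by simp
    then have "(\<Sum>j<n. es ! j * (w j \<bullet> w i)\<^sup>2) = (\<Sum>j<n. if j = i then es ! j else 0)"
      by (intro sum.cong) auto
    also have "\<dots> = es ! i" using i by simp
    finally show ?thesis using image[OF w, of i] zero_le_power2[of "vec_2norm (X *\<^sub>v w i)"] by simp
  qed
  have sorted: "es ! j \<le> es ! i" if "i \<le> j" "j < n" for i j
  proof -
    have "sorted (rev es)" by (simp add: es_def)
    then show ?thesis using that len sorted_rev_nth_mono[of es i j] by simp
  qed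
  have "singular_value X k = sqrt (es ! (k - 1))" if "1 \<le> k" "k \<le> min m n" for k
    using that X by (simp add: singular_value_def es_def A_def)
  then have "right_singular_basis X w (\<lambda>i. es ! i)"
    unfolding right_singular_basis_def Let_def n_def[symmetric] m_def[symmetric]
    using w nonneg sorted norm image by simp
  then show thesis by (rule that)
qed

lemma singular_value_nonneg: "singular_value X k \<ge> 0"
proof (cases "1 \<le> k \<and> k \<le> min (dim_row X) (dim_col X)")
  case True
  obtain w l where bl: "right_singular_basis X w l" by (rule right_singular_basis_exists)
  note l = right_singular_basisD[OF carrier_matI[OF refl refl] bl]
  have "l (k - 1) \<ge> 0" using True by (intro l(2)) auto
  then show ?thesis using True l(6) by simp
qed (auto simp: singular_value_def)

lemma singular_value_antimono:
  assumes "1 \<le> i" "i \<le> j"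
  shows "singular_value X j \<le> singular_value X i"
proof (cases "j \<le> min (dim_row X) (dim_col X)")
  case True
  obtain w l where bl: "right_singular_basis X w l" by (rule right_singular_basis_exists)
  note l = right_singular_basisD[OF carrier_matI[OF refl refl] bl]
  have "l (j - 1) \<le> l (i - 1)" using True assms by (intro l(3)) auto
  then show ?thesis using True assms l(6) by simp
next
  case False
  \<comment> \<open>Indices beyond the range have the default value 0, so nonnegativity
    suffices.\<close>
  then have "singular_value X j = 0" unfolding singular_value_def by (auto simp del: min_less_iff_conj min.bounded_iff)
  then show ?thesis using singular_value_nonneg by simp
qed

text \<open>In the coordinates \<open>w i \<bullet> x\<close> the squared norm of the image is a
  weighted sum, and \<open>l 0\<close> is the largest weight.\<close>

lemma norm_mult_le_singular_value_1:
  assumes X: "X \<in> carrier_mat m n" and "1 \<le> min m n" and x: "x \<in> carrier_vec n"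
  shows "vec_2norm (X *\<^sub>v x) \<le> singular_value X 1 * vec_2norm x"
proof -
  obtain w l where bl: "right_singular_basis X w l" by (rule right_singular_basis_exists)
  note l = right_singular_basisD[OF X bl]
  have "(vec_2norm (X *\<^sub>v x))\<^sup>2 \<le> (\<Sum>i<n. l 0 * (w i \<bullet> x)\<^sup>2)"
    unfolding l(5)[OF x] by (intro sum_mono mult_right_mono l(3)) auto
  also have "\<dots> = l 0 * (vec_2norm x)\<^sup>2" unfolding l(4)[OF x] by (simp add: sum_distrib_left)
  also have "\<dots> = (singular_value X 1 * vec_2norm x)\<^sup>2"
    using l(6)[of 1] l(2)[of 0] assms(2) by (simp add: power_mult_distrib)
  finally show ?thesis
    by (rule power2_le_imp_le) (simp add: singular_value_nonneg)
qed

text \<open>Dually, \<open>l (n - 1)\<close> is the smallest weight, and \<open>n \<le> m\<close>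
  makes it the square of \<open>singular_value X n\<close>.\<close>

lemma norm_mult_ge_last_singular_value:
  assumes X: "X \<in> carrier_mat m n" and "1 \<le> n" "n \<le> m" and x: "x \<in> carrier_vec n"
  shows "singular_value X n * vec_2norm x \<le> vec_2norm (X *\<^sub>v x)"
proof -
  obtain w l where bl: "right_singular_basis X w l" by (rule right_singular_basis_exists)
  note l = right_singular_basisD[OF X bl]
  have "(singular_value X n)\<^sup>2 = l (n - 1)" using l(6)[of n] l(2)[of "n - 1"] assms by simp
  then have "(singular_value X n)\<^sup>2 * (vec_2norm x)\<^sup>2 = (\<Sum>i<n. l (n - 1) * (w i \<bullet> x)\<^sup>2)"
    unfolding l(4)[OF x] by (simp add: sum_distrib_left)
  also have "\<dots> \<le> (vec_2norm (X *\<^sub>v x))\<^sup>2"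
    unfolding l(5)[OF x] by (intro sum_mono mult_right_mono l(3)) (use assms in auto)
  finally show ?thesis unfolding power_mult_distrib[symmetric] by (rule power2_le_imp_le) simp
qed

lemma norm_mult_le_spectral_norm:
  assumes M: "M \<in> carrier_mat m n" and "1 \<le> min m n" and x: "x \<in> carrier_vec n"
  shows "vec_2norm (M *\<^sub>v x) \<le> spectral_norm M * vec_2norm x"
proof (rule le_spectral_norm[OF M x])
  show "vec_2norm (M *\<^sub>v y) \<le> singular_value M 1 * vec_2norm y" if "y \<in> carrier_vec n" for y
    using norm_mult_le_singular_value_1[OF M assms(2) that] .
qed (rule singular_value_nonneg)

text \<open>Some \<open>z \<noteq> 0\<close> is orthogonal to the first \<open>s - 1\<close> right singular vectors of \<open>Y\<close> and to the last
  \<open>n - s\<close> ones of \<open>X\<close>, as these are only \<open>n - 1\<close> conditions.\<close>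

lemma singular_value_perturbation:
  assumes X: "X \<in> carrier_mat m n" and Y: "Y \<in> carrier_mat m n" and s: "1 \<le> s" "s \<le> min m n"
    and diff: "\<And>x. x \<in> carrier_vec n \<Longrightarrow> vec_2norm ((X - Y) *\<^sub>v x) \<le> e * vec_2norm x"
  shows "singular_value X s \<le> singular_value Y s + e"
proof -
  obtain w l where bl: "right_singular_basis X w l" by (rule right_singular_basis_exists)
  note l = right_singular_basisD[OF X bl]
  obtain w' l' where bl': "right_singular_basis Y w' l'" by (rule right_singular_basis_exists)
  note l' = right_singular_basisD[OF Y bl']
  have s1: "s - 1 < n" using s by linarith
  \<comment> \<open>The rows encode \<open>s - 1\<close> conditions from \<open>Y\<close> and
    \<open>n - s\<close> from \<open>X\<close>. The zero row in between makes \<open>T\<close>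
    square and puts a unit vector into the kernel of its transpose, so \<open>det T = 0\<close> and
    \<open>T\<close> has a kernel vector \<open>z\<close>.\<close>
  define T where "T = mat n n (\<lambda>(i, j). if i < s - 1 then w' i $ j else if i < s then 0 else w i $ j)"
  have T: "T \<in> carrier_mat n n" by (simp add: T_def)
  have "T\<^sup>T *\<^sub>v unit_vec n (s - 1) = 0\<^sub>v n"
    using s by (intro eq_vecI) (auto simp: T_def)
  moreover have "unit_vec n (s - 1) \<noteq> (0\<^sub>v n :: real vec)"
  proof
    assume h: "unit_vec n (s - 1) = (0\<^sub>v n :: real vec)"
    show False using arg_cong[OF h, of "\<lambda>v. v $ (s - 1)"] s by simp
  qed
  ultimately have "\<exists>v. v \<in> carrier_vec n \<and> v \<noteq> 0\<^sub>v n \<and> T\<^sup>T *\<^sub>v v = 0\<^sub>v n"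
    using unit_vec_carrier by blast
  then have "det (T\<^sup>T) = 0" using det_0_iff_vec_prod_zero[of "T\<^sup>T" n] T by simp
  then have "det T = 0" using det_transpose[OF T] by simp
  then obtain z where z: "z \<in> carrier_vec n" "z \<noteq> 0\<^sub>v n" "T *\<^sub>v z = 0\<^sub>v n"
    using det_0_iff_vec_prod_zero[OF T] by auto
  have Tz: "row T i \<bullet> z = 0" if "i < n" for i
    using arg_cong[OF z(3), of "\<lambda>v. v $ i"] that T by simp
  have orth': "w' i \<bullet> z = 0" if "i < s - 1" for i
  proof -
    have "i < n" using that s by linarith
    moreover have "row T i = w' i" using that s carrier_vecD[OF l'(1)[of i]] by (intro eq_vecI) (auto simp: T_def)
    ultimately show ?thesis using Tz[of i] by simp
  qed
  have orth: "w i \<bullet> z = 0" if "s \<le> i" "i < n" for i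
  proof -
    have "row T i = w i" using that s carrier_vecD[OF l(1)[of i]] by (intro eq_vecI) (auto simp: T_def)
    then show ?thesis using Tz[of i] that s by simp
  qed
  have znorm: "vec_2norm z > 0"
    using z vec_2norm_eq_0_iff[of z] vec_2norm_nonneg[of z] by (auto simp: less_le)
  \<comment> \<open>For \<open>X\<close> the coordinates of \<open>z\<close> from \<open>s\<close>
    on vanish, and the other weights are at least \<open>l (s - 1)\<close>. For \<open>Y\<close>,
    further below, the first \<open>s - 1\<close> coordinates vanish and the other weights are at
    most \<open>l' (s - 1)\<close>.\<close>
  have "(singular_value X s)\<^sup>2 * (vec_2norm z)\<^sup>2 = (\<Sum>i<n. l (s - 1) * (w i \<bullet> z)\<^sup>2)"
    using l(2)[OF s1] l(6)[of s] s unfolding l(4)[OF z(1)] by (simp add: sum_distrib_left)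
  also have "\<dots> \<le> (\<Sum>i<n. l i * (w i \<bullet> z)\<^sup>2)"
  proof (rule sum_mono)
    fix i assume i: "i \<in> {..<n}"
    show "l (s - 1) * (w i \<bullet> z)\<^sup>2 \<le> l i * (w i \<bullet> z)\<^sup>2"
    proof (cases "i < s")
      case True
      then show ?thesis using i s by (intro mult_right_mono l(3)) auto
    qed (use orth[of i] i in simp)
  qed
  also have "\<dots> = (vec_2norm (X *\<^sub>v z))\<^sup>2" by (rule l(5)[OF z(1), symmetric])
  finally have lower: "singular_value X s * vec_2norm z \<le> vec_2norm (X *\<^sub>v z)"
    unfolding power_mult_distrib[symmetric] by (rule power2_le_imp_le) simp
  have "(vec_2norm (Y *\<^sub>v z))\<^sup>2 \<le> (\<Sum>i<n. l' (s - 1) * (w' i \<bullet> z)\<^sup>2)"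
    unfolding l'(5)[OF z(1)]
  proof (rule sum_mono)
    fix i assume i: "i \<in> {..<n}"
    show "l' i * (w' i \<bullet> z)\<^sup>2 \<le> l' (s - 1) * (w' i \<bullet> z)\<^sup>2"
    proof (cases "i < s - 1")
      case False
      then show ?thesis using i by (intro mult_right_mono l'(3)) auto
    qed (use orth'[of i] in simp)
  qed
  also have "\<dots> = (singular_value Y s)\<^sup>2 * (vec_2norm z)\<^sup>2"
    using l'(2)[OF s1] l'(6)[of s] s unfolding l'(4)[OF z(1)] by (simp add: sum_distrib_left)
  finally have upper: "vec_2norm (Y *\<^sub>v z) \<le> singular_value Y s * vec_2norm z"
    unfolding power_mult_distrib[symmetric]
    by (rule power2_le_imp_le) (simp add: singular_value_nonneg)
  have "vec_2norm (X *\<^sub>v z) \<le> vec_2norm (Y *\<^sub>v z) + vec_2norm ((X - Y) *\<^sub>v z)"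
    using vec_2norm_le_plus_diff[of "X *\<^sub>v z" m "Y *\<^sub>v z"] X Y z(1)
    by (simp add: minus_mult_distrib_mat_vec[OF X Y z(1)])
  with lower upper diff[OF z(1)]
  have "singular_value X s * vec_2norm z \<le> (singular_value Y s + e) * vec_2norm z"
    by (simp add: algebra_simps)
  then show ?thesis using znorm by simp
qed

section \<open>Partial sums of the singular value decomposition\<close>

text \<open>Given entrywise, so that the dimension \<open>d\<close> is fixed even for an empty index
  set.\<close>

definition vec_comb :: "nat \<Rightarrow> nat set \<Rightarrow> (nat \<Rightarrow> real) \<Rightarrow> (nat \<Rightarrow> real vec) \<Rightarrow> real vec" where
  "vec_comb d I c u = vec d (\<lambda>a. \<Sum>i\<in>I. c i * u i $ a)"

lemma vec_comb_carrier [simp]: "vec_comb d I c u \<in> carrier_vec d"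
  by (simp add: vec_comb_def)

lemma scalar_prod_vec_comb:
  assumes "w \<in> carrier_vec d" "\<And>i. i \<in> I \<Longrightarrow> u i \<in> carrier_vec d"
  shows "w \<bullet> vec_comb d I c u = (\<Sum>i\<in>I. c i * (w \<bullet> u i))"
proof -
  have "w \<bullet> vec_comb d I c u = (\<Sum>a = 0..<d. \<Sum>i\<in>I. c i * (w $ a * u i $ a))"
    by (simp add: scalar_prod_def vec_comb_def sum_distrib_left ac_simps)
  also have "\<dots> = (\<Sum>i\<in>I. \<Sum>a = 0..<d. c i * (w $ a * u i $ a))" by (rule sum.swap)
  also have "\<dots> = (\<Sum>i\<in>I. c i * (w \<bullet> u i))"
  proof (rule sum.cong)
    fix i assume "i \<in> I"
    then have "dim_vec (u i) = d" using assms(2) by auto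
    then show "(\<Sum>a = 0..<d. c i * (w $ a * u i $ a)) = c i * (w \<bullet> u i)"
      by (simp add: scalar_prod_def sum_distrib_left)
  qed simp
  finally show ?thesis .
qed

text \<open>Pythagoras: by orthonormality the pairing of the combination with \<open>u i\<close>
  returns the coefficient \<open>c i\<close>.\<close>

lemma vec_comb_norm:
  assumes u: "orthonormal_family d r u" and I: "I \<subseteq> {1..r}"
  shows "(vec_2norm (vec_comb d I c u))\<^sup>2 = (\<Sum>i\<in>I. (c i)\<^sup>2)"
proof -
  have uc: "u i \<in> carrier_vec d" if "i \<in> I" for i
    using u I that by (auto simp: orthonormal_family_def)
  have fin: "finite I" using I finite_subset by blast
  have "vec_comb d I c u \<bullet> u i = c i" if i: "i \<in> I" for i
  proof -
    have "vec_comb d I c u \<bullet> u i = u i \<bullet> vec_comb d I c u"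
      using uc[OF i] by (intro comm_scalar_prod[of _ d]) auto
    also have "\<dots> = (\<Sum>j\<in>I. c j * (u i \<bullet> u j))" using uc i by (intro scalar_prod_vec_comb) auto
    also have "\<dots> = (\<Sum>j\<in>I. if j = i then c j else 0)"
      using u I i by (intro sum.cong) (auto simp: orthonormal_family_def subset_iff)
    finally show ?thesis using i fin by simp
  qed
  then show ?thesis
    unfolding vec_2norm_sq using uc by (subst scalar_prod_vec_comb) (auto simp: power2_eq_square)
qed

text \<open>With \<open>y\<close> the orthogonal projection of \<open>z\<close> onto the span of the
  \<open>v i\<close>, the squared norm of \<open>z - y\<close> is the right-hand side minus the
  left-hand side.\<close>

lemma bessel_inequality:
  assumes v: "orthonormal_family d r v" and I: "I \<subseteq> {1..r}" and z: "z \<in> carrier_vec d"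
  shows "(\<Sum>i\<in>I. (v i \<bullet> z)\<^sup>2) \<le> (vec_2norm z)\<^sup>2"
proof -
  have vc: "v i \<in> carrier_vec d" if "i \<in> I" for i
    using v I that by (auto simp: orthonormal_family_def)
  let ?q = "\<Sum>i\<in>I. (v i \<bullet> z)\<^sup>2"
  define y where "y = vec_comb d I (\<lambda>i. v i \<bullet> z) v"
  have y: "y \<in> carrier_vec d" by (simp add: y_def)
  have yy: "y \<bullet> y = ?q" using vec_comb_norm[OF v I] by (simp add: y_def vec_2norm_sq)
  have "z \<bullet> y = (\<Sum>i\<in>I. (v i \<bullet> z) * (z \<bullet> v i))"
    unfolding y_def using z vc by (rule scalar_prod_vec_comb)
  also have "\<dots> = ?q"
    using vc z comm_scalar_prod[of z d] by (intro sum.cong) (auto simp: power2_eq_square)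
  finally have zy: "z \<bullet> y = ?q" .
  have "(z - y) \<bullet> (z - y) = z \<bullet> z - z \<bullet> y - (y \<bullet> z - y \<bullet> y)"
    using y z by (simp add: scalar_prod_minus_distrib[of _ d] minus_scalar_prod_distrib[of _ d])
  also have "y \<bullet> z = z \<bullet> y" using y z by (intro comm_scalar_prod)
  finally have "(vec_2norm (z - y))\<^sup>2 = (vec_2norm z)\<^sup>2 - ?q"
    by (simp add: vec_2norm_sq zy yy)
  then show ?thesis using zero_le_power2[of "vec_2norm (z - y)"] by simp
qed

text \<open>Pythagoras for the output vectors \<open>u i\<close> and Bessel for the coefficients
  \<open>v i \<bullet> z\<close>. This serves both the head and the tail of a singular value
  decomposition.\<close>

lemma vec_comb_bound:
  assumes u: "orthonormal_family m r u" and v: "orthonormal_family n r v"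
    and I: "I \<subseteq> {1..r}" and z: "z \<in> carrier_vec n"
    and f: "\<And>i. i \<in> I \<Longrightarrow> 0 \<le> f i \<and> f i \<le> c" and c: "0 \<le> c"
  shows "vec_2norm (vec_comb m I (\<lambda>i. f i * (v i \<bullet> z)) u) \<le> c * vec_2norm z"
proof (rule power2_le_imp_le)
  have "(vec_2norm (vec_comb m I (\<lambda>i. f i * (v i \<bullet> z)) u))\<^sup>2 = (\<Sum>i\<in>I. (f i)\<^sup>2 * (v i \<bullet> z)\<^sup>2)"
    unfolding vec_comb_norm[OF u I] by (simp add: power_mult_distrib)
  also have "\<dots> \<le> (\<Sum>i\<in>I. c\<^sup>2 * (v i \<bullet> z)\<^sup>2)"
    using f by (intro sum_mono mult_right_mono power_mono) auto
  also have "\<dots> = c\<^sup>2 * (\<Sum>i\<in>I. (v i \<bullet> z)\<^sup>2)" by (simp add: sum_distrib_left)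
  also have "\<dots> \<le> c\<^sup>2 * (vec_2norm z)\<^sup>2"
    by (intro mult_left_mono bessel_inequality[OF v I z]) simp
  finally show "(vec_2norm (vec_comb m I (\<lambda>i. f i * (v i \<bullet> z)) u))\<^sup>2 \<le> (c * vec_2norm z)\<^sup>2"
    by (simp add: power_mult_distrib)
qed (simp add: c)

lemma svd_sum_mult_vec:
  assumes M: "M \<in> carrier_mat m n" and z: "z \<in> carrier_vec n"
    and v: "\<And>i. i \<in> {1..k} \<Longrightarrow> v i \<in> carrier_vec n"
  shows "svd_sum M u v k *\<^sub>v z = vec_comb m {1..k} (\<lambda>i. singular_value M i * (v i \<bullet> z)) u"
proof (rule eq_vecI)
  fix a assume "a < dim_vec (vec_comb m {1..k} (\<lambda>i. singular_value M i * (v i \<bullet> z)) u)"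
  then have a: "a < m" by (simp add: vec_comb_def)
  let ?s = "singular_value M"
  have "(svd_sum M u v k *\<^sub>v z) $ a = (\<Sum>b = 0..<n. (\<Sum>i = 1..k. ?s i * u i $ a * v i $ b) * z $ b)"
    using a M z by (simp add: svd_sum_def scalar_prod_def)
  also have "\<dots> = (\<Sum>b = 0..<n. \<Sum>i = 1..k. ?s i * (v i $ b * z $ b) * u i $ a)"
    by (simp add: sum_distrib_left sum_distrib_right ac_simps)
  also have "\<dots> = (\<Sum>i = 1..k. \<Sum>b = 0..<n. ?s i * (v i $ b * z $ b) * u i $ a)" by (rule sum.swap)
  also have "\<dots> = (\<Sum>i = 1..k. ?s i * (v i \<bullet> z) * u i $ a)"
    using z by (simp add: scalar_prod_def sum_distrib_left sum_distrib_right)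
  finally show "(svd_sum M u v k *\<^sub>v z) $ a
      = vec_comb m {1..k} (\<lambda>i. singular_value M i * (v i \<bullet> z)) u $ a"
    using a by (simp add: vec_comb_def)
qed (use M in \<open>simp add: svd_sum_def vec_comb_def\<close>)

lemma svd_sum_norm_bound:
  assumes M: "M \<in> carrier_mat m n" and svd: "is_svd M u v" and k: "k \<le> min m n"
    and z: "z \<in> carrier_vec n"
  shows "vec_2norm (svd_sum M u v k *\<^sub>v z) \<le> singular_value M 1 * vec_2norm z"
proof -
  have o: "orthonormal_family m (min m n) u" "orthonormal_family n (min m n) v"
    using svd M by (auto simp: is_svd_def Let_def)
  have v: "v i \<in> carrier_vec n" if "i \<in> {1..k}" for i
    using o(2) k that by (auto simp: orthonormal_family_def)
  have "svd_sum M u v k *\<^sub>v z = vec_comb m {1..k} (\<lambda>i. singular_value M i * (v i \<bullet> z)) u"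
    using v by (rule svd_sum_mult_vec[OF M z])
  then have eq: "vec_2norm (svd_sum M u v k *\<^sub>v z)
      = vec_2norm (vec_comb m {1..k} (\<lambda>i. singular_value M i * (v i \<bullet> z)) u)" by simp
  show ?thesis
    unfolding eq by (rule vec_comb_bound[OF o _ z])
      (use k in \<open>auto intro: singular_value_nonneg singular_value_antimono\<close>)
qed

text \<open>The difference is the tail over \<open>k + 1..r\<close>, where no singular value exceeds
  the one at \<open>k + 1\<close>. If \<open>k = r\<close>, the tail is empty and the bound is 0 by
  the default value of \<open>singular_value\<close>.\<close>

lemma svd_sum_error_bound:
  assumes M: "M \<in> carrier_mat m n" and svd: "is_svd M u v" and k: "k \<le> min m n"
    and z: "z \<in> carrier_vec n"
  shows "vec_2norm (M *\<^sub>v z - svd_sum M u v k *\<^sub>v z) \<le> singular_value M (k + 1) * vec_2norm z"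
proof -
  define r where "r = min m n"
  have o: "orthonormal_family m r u" "orthonormal_family n r v" and Msum: "M = svd_sum M u v r"
    using svd M by (auto simp: is_svd_def Let_def r_def)
  have v: "v i \<in> carrier_vec n" if "i \<in> {1..r}" for i
    using o(2) that by (auto simp: orthonormal_family_def)
  let ?c = "\<lambda>i. singular_value M i * (v i \<bullet> z)"
  have un: "{1..r} = {1..k} \<union> {k + 1..r}" using k by (auto simp: r_def)
  have "M *\<^sub>v z = vec_comb m {1..r} ?c u"
    by (subst Msum) (rule svd_sum_mult_vec[OF M z v])
  moreover have "svd_sum M u v k *\<^sub>v z = vec_comb m {1..k} ?c u"
    using k by (intro svd_sum_mult_vec[OF M z v]) (auto simp: r_def)
  moreover have "vec_comb m {1..r} ?c u - vec_comb m {1..k} ?c u = vec_comb m {k + 1..r} ?c u"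
    unfolding un by (intro eq_vecI) (auto simp: vec_comb_def sum.union_disjoint)
  ultimately show ?thesis
    by simp (rule vec_comb_bound[OF o _ z],
      auto intro: singular_value_nonneg singular_value_antimono)
qed

section \<open>Residuals of block matrices\<close>

lemma append_vec_diff:
  assumes "a \<in> carrier_vec k" "c \<in> carrier_vec k" "b \<in> carrier_vec l" "d \<in> carrier_vec l"
  shows "(a @\<^sub>v b) - (c @\<^sub>v d) = (a - c) @\<^sub>v (b - d :: real vec)"
  using assms by (intro eq_vecI) auto

lemma append_cols_mult_vec:
  fixes A B :: "real mat"
  assumes "A \<in> carrier_mat k s" "B \<in> carrier_mat k q" "x \<in> carrier_vec s" "y \<in> carrier_vec q"
  shows "append_cols A B *\<^sub>v (x @\<^sub>v y) = A *\<^sub>v x + B *\<^sub>v y"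
proof -
  have "append_cols A B *\<^sub>v (x @\<^sub>v y)
      = (A *\<^sub>v x + B *\<^sub>v y) @\<^sub>v (0\<^sub>m 0 s *\<^sub>v x + 0\<^sub>m 0 q *\<^sub>v y)"
    unfolding append_cols_def using assms by (subst four_block_mat_mult_vec[of _ k s _ q _ 0]) auto
  also have "\<dots> = A *\<^sub>v x + B *\<^sub>v y" using assms by (intro eq_vecI) auto
  finally show ?thesis .
qed

lemma mult_mat_zero_vec: "A \<in> carrier_mat m n \<Longrightarrow> A *\<^sub>v 0\<^sub>v n = (0\<^sub>v m :: real vec)"
  by (intro eq_vecI) auto

lemma invertible_of_trivial_kernel:
  fixes V :: "real mat"
  assumes V: "V \<in> carrier_mat s s" and inj: "\<And>x. x \<in> carrier_vec s \<Longrightarrow> V *\<^sub>v x = 0\<^sub>v s \<Longrightarrow> x = 0\<^sub>v s"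
  obtains W where "W \<in> carrier_mat s s" "V * W = 1\<^sub>m s"
proof -
  have "det V \<noteq> 0" using det_0_iff_vec_prod_zero[OF V] inj by blast
  from det_non_zero_imp_unit[OF V this] show thesis
    using that by (auto simp: Units_def ring_mat_simps)
qed

text \<open>The orthogonality conditions form a square linear system for \<open>x\<close>, whose
  right-hand side comes from \<open>y\<close>; a trivial kernel makes it solvable. This produces
  kernel vectors of the truncated SVD with a prescribed lower part.\<close>

lemma orthogonal_completion:
  fixes v :: "nat \<Rightarrow> real vec"
  assumes v: "\<And>i. i \<in> {1..s} \<Longrightarrow> v i \<in> carrier_vec (s + q)" and y: "y \<in> carrier_vec q"
    and inj: "\<And>x. x \<in> carrier_vec s \<Longrightarrow> (\<forall>i\<in>{1..s}. v i \<bullet> (x @\<^sub>v 0\<^sub>v q) = 0) \<Longrightarrow> x = 0\<^sub>v s"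
  obtains x where "x \<in> carrier_vec s" "\<forall>i\<in>{1..s}. v i \<bullet> (x @\<^sub>v y) = 0"
proof -
  \<comment> \<open>Matrix rows count from 0 and the vectors \<open>v\<close> from 1, hence
    \<open>Suc i\<close> here and \<open>i - 1\<close> below.\<close>
  define V where "V = mat s s (\<lambda>(i, j). v (Suc i) $ j)"
  have V: "V \<in> carrier_mat s s" by (simp add: V_def)
  have split: "v i \<bullet> (x @\<^sub>v y) = (V *\<^sub>v x) $ (i - 1) + vec_last (v i) q \<bullet> y"
    if "i \<in> {1..s}" "x \<in> carrier_vec s" "y \<in> carrier_vec q" for i x y
  proof -
    have "v i \<bullet> (x @\<^sub>v y) = (vec_first (v i) s @\<^sub>v vec_last (v i) q) \<bullet> (x @\<^sub>v y)"
      using v[OF that(1)] by simp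
    also have "\<dots> = vec_first (v i) s \<bullet> x + vec_last (v i) q \<bullet> y"
      using that by (intro scalar_prod_append) auto
    also have "vec_first (v i) s = row V (i - 1)"
      using that(1) v[OF that(1)] by (intro eq_vecI) (auto simp: V_def vec_first_def)
    moreover have "i - 1 < s" using that(1) by auto
    ultimately show ?thesis using V by simp
  qed
  have "x = 0\<^sub>v s" if x: "x \<in> carrier_vec s" and Vx: "V *\<^sub>v x = 0\<^sub>v s" for x
  proof (rule inj[OF x])
    show "\<forall>i\<in>{1..s}. v i \<bullet> (x @\<^sub>v 0\<^sub>v q) = 0"
    proof
      fix i assume i: "i \<in> {1..s}"
      then have "i - 1 < s" by auto
      then show "v i \<bullet> (x @\<^sub>v 0\<^sub>v q) = 0"
        using split[OF i x, of "0\<^sub>v q"] Vx by simp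
    qed
  qed
  then obtain W where W: "W \<in> carrier_mat s s" "V * W = 1\<^sub>m s"
    using invertible_of_trivial_kernel[OF V] by blast
  define b where "b = vec s (\<lambda>i. - (vec_last (v (Suc i)) q \<bullet> y))"
  have b: "b \<in> carrier_vec s" by (simp add: b_def)
  have "V *\<^sub>v (W *\<^sub>v b) = b"
    using assoc_mult_mat_vec[OF V W(1) b, symmetric] W(2) b by simp
  then have "v i \<bullet> ((W *\<^sub>v b) @\<^sub>v y) = 0" if i: "i \<in> {1..s}" for i
  proof -
    have "i - 1 < s" "Suc (i - 1) = i" using i by auto
    then have "b $ (i - 1) = - (vec_last (v i) q \<bullet> y)" by (simp add: b_def)
    then show ?thesis using split[OF i _ y, of "W *\<^sub>v b"] \<open>V *\<^sub>v (W *\<^sub>v b) = b\<close> W(1) b by simp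
  qed
  then show thesis using that[of "W *\<^sub>v b"] W(1) b by simp
qed

text \<open>The top block of the image of \<open>(-c x, y)\<close> is \<open>-(1 + c) A x\<close>; the optimal choice is
  \<open>c = \<bar>y\<bar>\<^sup>2 / \<bar>x\<bar>\<^sup>2\<close>.\<close>

lemma kernel_vector_bound:
  assumes blocks: "A \<in> carrier_mat s s" "B \<in> carrier_mat s q" "F \<in> carrier_mat p s" "C \<in> carrier_mat p q"
    and x: "x \<in> carrier_vec s" and y: "y \<in> carrier_vec q"
    and upper: "\<And>z. z \<in> carrier_vec (s + q) \<Longrightarrow> vec_2norm (four_block_mat A B F C *\<^sub>v z) \<le> \<sigma> * vec_2norm z"
    and lower: "d * vec_2norm x \<le> vec_2norm (A *\<^sub>v x)"
    and d: "0 \<le> d" "d \<le> \<sigma>" and ker: "A *\<^sub>v x + B *\<^sub>v y = 0\<^sub>v s"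
  shows "d * vec_2norm (x @\<^sub>v y) \<le> \<sigma> * vec_2norm y"
proof (rule power2_le_imp_le)
  define P where "P = (vec_2norm x)\<^sup>2"
  define Q where "Q = (vec_2norm y)\<^sup>2"
  have PQ: "P \<ge> 0" "Q \<ge> 0" by (auto simp: P_def Q_def)
  have "d\<^sup>2 * (P + Q) \<le> \<sigma>\<^sup>2 * Q"
  proof (cases "P = 0")
    \<comment> \<open>For \<open>x = 0\<close> the claim reduces to
      \<open>d \<le> \<sigma>\<close>.\<close>
    case True
    then show ?thesis using d PQ by (auto intro!: mult_right_mono power_mono)
  next
    case False
    define c where "c = Q / P"
    have c: "c \<ge> 0" using PQ by (simp add: c_def)
    let ?z = "(- c) \<cdot>\<^sub>v x @\<^sub>v y"
    \<comment> \<open>The kernel equation replaces \<open>B *\<^sub>v y\<close> by the negative of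
      \<open>A *\<^sub>v x\<close>.\<close>
    have "A *\<^sub>v ((- c) \<cdot>\<^sub>v x) + B *\<^sub>v y = (- (1 + c)) \<cdot>\<^sub>v (A *\<^sub>v x)"
    proof (rule eq_vecI)
      fix i assume "i < dim_vec ((- (1 + c)) \<cdot>\<^sub>v (A *\<^sub>v x))"
      then have i: "i < s" using blocks by simp
      have "(A *\<^sub>v x) $ i + (B *\<^sub>v y) $ i = 0"
        using arg_cong[OF ker, of "\<lambda>v. v $ i"] i blocks by simp
      then show "(A *\<^sub>v ((- c) \<cdot>\<^sub>v x) + B *\<^sub>v y) $ i = ((- (1 + c)) \<cdot>\<^sub>v (A *\<^sub>v x)) $ i"
        unfolding mult_mat_vec[OF blocks(1) x] using i blocks by (simp add: algebra_simps)
    qed (use blocks in simp)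
    then have img: "four_block_mat A B F C *\<^sub>v ?z
        = (- (1 + c)) \<cdot>\<^sub>v (A *\<^sub>v x) @\<^sub>v (F *\<^sub>v ((- c) \<cdot>\<^sub>v x) + C *\<^sub>v y)"
      using four_block_mat_mult_vec[OF blocks, of "(- c) \<cdot>\<^sub>v x" y] x y by simp
    have "(1 + c) * (d * vec_2norm x) \<le> (1 + c) * vec_2norm (A *\<^sub>v x)"
      using lower c by (intro mult_left_mono) auto
    also have "\<dots> = vec_2norm ((- (1 + c)) \<cdot>\<^sub>v (A *\<^sub>v x))" using c by (simp add: vec_2norm_smult)
    also have "\<dots> \<le> vec_2norm (four_block_mat A B F C *\<^sub>v ?z)"
      unfolding img by (rule vec_2norm_append_le)
    also have "\<dots> \<le> \<sigma> * vec_2norm ?z" using x y by (intro upper) simp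
    finally have "((1 + c) * (d * vec_2norm x))\<^sup>2 \<le> (\<sigma> * vec_2norm ?z)\<^sup>2"
      using c d by (intro power_mono) auto
    then have "(1 + c)\<^sup>2 * (d\<^sup>2 * P) \<le> \<sigma>\<^sup>2 * (c\<^sup>2 * P + Q)"
      by (simp add: power_mult_distrib vec_2norm_append_sq vec_2norm_smult P_def Q_def)
    \<comment> \<open>Since \<open>1 + c = (P + Q) / P\<close>, both sides contain the positive
      factor \<open>(P + Q) / P\<close>; cancelling it leaves the claim.\<close>
    moreover have "(1 + c)\<^sup>2 * (d\<^sup>2 * P) = (P + Q) / P * (d\<^sup>2 * (P + Q))"
      using False by (simp add: c_def field_simps power2_eq_square)
    moreover have "\<sigma>\<^sup>2 * (c\<^sup>2 * P + Q) = (P + Q) / P * (\<sigma>\<^sup>2 * Q)"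
      using False by (simp add: c_def field_simps power2_eq_square)
    moreover have "(P + Q) / P > 0" using False PQ by simp
    ultimately show ?thesis by (metis mult_le_cancel_left_pos)
  qed
  then show "(d * vec_2norm (x @\<^sub>v y))\<^sup>2 \<le> (\<sigma> * vec_2norm y)\<^sup>2"
    by (simp add: power_mult_distrib vec_2norm_append_sq P_def Q_def)
qed (use d in simp)

text \<open>The image of \<open>(w, 0)\<close> is \<open>(A w, F w)\<close>, so the bounds
  \<open>upper\<close> and \<open>lower\<close> control \<open>F w\<close> by \<open>A w\<close>.
  Balancing the cross term between \<open>g\<close> and \<open>F w\<close> then gives the constant
  \<open>\<sigma>\<close> for the whole pair, sharper than bounding both terms separately.\<close>

lemma schur_residual_bound:
  assumes blocks: "A \<in> carrier_mat s s" "B \<in> carrier_mat s q" "F \<in> carrier_mat p s" "C \<in> carrier_mat p q"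
    and w: "w \<in> carrier_vec s" and g: "g \<in> carrier_vec p"
    and upper: "\<And>z. z \<in> carrier_vec (s + q) \<Longrightarrow> vec_2norm (four_block_mat A B F C *\<^sub>v z) \<le> \<sigma> * vec_2norm z"
    and lower: "d * vec_2norm w \<le> vec_2norm (A *\<^sub>v w)"
    and d: "0 \<le> d" "d \<le> \<sigma>"
  shows "d * vec_2norm (g - F *\<^sub>v w) \<le> \<sigma> * vec_2norm (A *\<^sub>v w @\<^sub>v g)"
proof -
  define f h a where "f = vec_2norm (A *\<^sub>v w)" and "h = vec_2norm (F *\<^sub>v w)" and "a = vec_2norm g"
  \<comment> \<open>This is the constant in \<open>(d * h)\<^sup>2 \<le> k * f\<^sup>2\<close>; the
    weights \<open>k\<close> and \<open>d\<^sup>2\<close> add up to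
    \<open>\<sigma>\<^sup>2\<close>.\<close>
  define k where "k = \<sigma>\<^sup>2 - d\<^sup>2"
  have nn: "f \<ge> 0" "h \<ge> 0" "a \<ge> 0" by (auto simp: f_def h_def a_def)
  have k: "k \<ge> 0" using d by (simp add: k_def power_mono)
  have "four_block_mat A B F C *\<^sub>v (w @\<^sub>v 0\<^sub>v q) = A *\<^sub>v w @\<^sub>v F *\<^sub>v w"
    using four_block_mat_mult_vec[OF blocks w, of "0\<^sub>v q"] blocks w
    by (simp add: mult_mat_zero_vec)
  then have "vec_2norm (A *\<^sub>v w @\<^sub>v F *\<^sub>v w) \<le> \<sigma> * vec_2norm (w @\<^sub>v 0\<^sub>v q)"
    using upper[of "w @\<^sub>v 0\<^sub>v q"] w by simp
  then have "(vec_2norm (A *\<^sub>v w @\<^sub>v F *\<^sub>v w))\<^sup>2 \<le> (\<sigma> * vec_2norm (w @\<^sub>v 0\<^sub>v q))\<^sup>2"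
    by (intro power_mono) auto
  then have "f\<^sup>2 + h\<^sup>2 \<le> \<sigma>\<^sup>2 * (vec_2norm w)\<^sup>2"
    by (simp add: power_mult_distrib vec_2norm_append_sq f_def h_def vec_2norm_sq[of "0\<^sub>v q"])
  then have "d\<^sup>2 * (f\<^sup>2 + h\<^sup>2) \<le> d\<^sup>2 * (\<sigma>\<^sup>2 * (vec_2norm w)\<^sup>2)" by (intro mult_left_mono) auto
  also have "\<dots> = \<sigma>\<^sup>2 * (d * vec_2norm w)\<^sup>2" by (simp add: power_mult_distrib)
  also have "\<dots> \<le> \<sigma>\<^sup>2 * f\<^sup>2" using lower d by (intro mult_left_mono power_mono) (auto simp: f_def)
  finally have fh: "(d * h)\<^sup>2 \<le> k * f\<^sup>2"
    by (simp add: k_def power_mult_distrib distrib_left left_diff_distrib)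
  also have "k * f\<^sup>2 = (sqrt k * f)\<^sup>2" using k by (simp add: power_mult_distrib)
  finally have "d * h \<le> sqrt k * f" by (rule power2_le_imp_le) (use k nn in simp)
  then have "d * a * (d * h) \<le> d * a * (sqrt k * f)" using d nn by (intro mult_left_mono) auto
  \<comment> \<open>Arithmetic-geometric mean inequality, weighted so that expanding
    \<open>(d * (a + h))\<^sup>2\<close> completes both coefficients to
    \<open>k + d\<^sup>2 = \<sigma>\<^sup>2\<close>.\<close>
  moreover have "2 * (d * a * (sqrt k * f)) \<le> (sqrt k * a)\<^sup>2 + (d * f)\<^sup>2"
    using zero_le_power2[of "sqrt k * a - d * f"] by (simp add: power2_eq_square algebra_simps)
  moreover have "(sqrt k * a)\<^sup>2 = k * a\<^sup>2" using k by (simp add: power_mult_distrib)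
  ultimately have "2 * (d * a * (d * h)) \<le> k * a\<^sup>2 + (d * f)\<^sup>2" by linarith
  then have "(d * (a + h))\<^sup>2 \<le> \<sigma>\<^sup>2 * (f\<^sup>2 + a\<^sup>2)"
    using fh by (simp add: k_def power2_eq_square algebra_simps)
  also have "\<dots> = (\<sigma> * vec_2norm (A *\<^sub>v w @\<^sub>v g))\<^sup>2"
    by (simp add: power_mult_distrib vec_2norm_append_sq f_def a_def)
  finally have "d * (a + h) \<le> \<sigma> * vec_2norm (A *\<^sub>v w @\<^sub>v g)"
    by (rule power2_le_imp_le) (use d in simp)
  moreover have "vec_2norm (g - F *\<^sub>v w) \<le> a + h"
    unfolding a_def h_def using g blocks w by (intro vec_2norm_diff_triangle) auto
  then have "d * vec_2norm (g - F *\<^sub>v w) \<le> d * (a + h)" using d by (intro mult_left_mono)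
  ultimately show ?thesis by linarith
qed

lemma top_block_diff_le:
  assumes "T \<in> carrier_mat (s + p) n" "T' \<in> carrier_mat (s + p) n" "z \<in> carrier_vec n"
    and "T *\<^sub>v z = a @\<^sub>v b" "T' *\<^sub>v z = a' @\<^sub>v b'"
    and "a \<in> carrier_vec s" "a' \<in> carrier_vec s" "b \<in> carrier_vec p" "b' \<in> carrier_vec p"
  shows "vec_2norm (a - a') \<le> vec_2norm ((T - T') *\<^sub>v z)"
  using assms vec_2norm_append_le(1)[of "a - a'" "b - b'"]
  by (simp add: minus_mult_distrib_mat_vec append_vec_diff[of a s a' b p b'])

text \<open>With \<open>R\<close> the inverse of \<open>A\<close>, the approximation reproduces the
  top part \<open>A x + B y\<close> exactly, so its residual lives in the lower part only.\<close>

lemma nystrom_mult_vec: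
  assumes A: "A \<in> carrier_mat s s" "invertible_mat A" and B: "B \<in> carrier_mat s q" and F: "F \<in> carrier_mat p s"
  obtains R where "R \<in> carrier_mat s s" "A * R = 1\<^sub>m s" "R * A = 1\<^sub>m s"
    "nystrom A B F \<in> carrier_mat (s + p) (s + q)"
    "\<And>x y. x \<in> carrier_vec s \<Longrightarrow> y \<in> carrier_vec q \<Longrightarrow> nystrom A B F *\<^sub>v (x @\<^sub>v y)
       = (A *\<^sub>v x + B *\<^sub>v y) @\<^sub>v (F *\<^sub>v (R *\<^sub>v (A *\<^sub>v x + B *\<^sub>v y)))"
proof -
  \<comment> \<open>The dimensions of the inverse are read off from the two products. Thus
    \<open>A\<close> is a unit of the matrix ring, and \<open>mat_inverse\<close> returns a genuine
    inverse.\<close>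
  obtain R' where R': "A * R' = 1\<^sub>m s" "R' * A = 1\<^sub>m (dim_row R')"
    using A by (auto simp: invertible_mat_def inverts_mat_def)
  have "dim_col R' = s" using arg_cong[OF R'(1), of dim_col] by simp
  moreover have "dim_row R' = s" using arg_cong[OF R'(2), of dim_col] A by simp
  ultimately have "A \<in> Units (ring_mat TYPE(real) s ())"
    using A R' unfolding Units_def ring_mat_simps by (auto intro!: bexI[of _ R'])
  then obtain R where R: "mat_inverse A = Some R"
    using mat_inverse(1)[OF A(1), of "()"] by (cases "mat_inverse A") auto
  from mat_inverse(2)[OF A(1) R] have inv: "A * R = 1\<^sub>m s" "R * A = 1\<^sub>m s" and Rc: "R \<in> carrier_mat s s" by auto
  have P: "append_rows A F \<in> carrier_mat (s + p) s" using A F by simp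
  have Q: "append_cols A B \<in> carrier_mat s (s + q)"
    using four_block_carrier_mat[of A s s "0\<^sub>m 0 q" 0 q B "0\<^sub>m 0 s"] A B by (simp add: append_cols_def)
  have nys: "nystrom A B F = append_rows A F * R * append_cols A B" by (simp add: nystrom_def R)
  have "nystrom A B F *\<^sub>v (x @\<^sub>v y) = (A *\<^sub>v x + B *\<^sub>v y) @\<^sub>v (F *\<^sub>v (R *\<^sub>v (A *\<^sub>v x + B *\<^sub>v y)))"
    if x: "x \<in> carrier_vec s" and y: "y \<in> carrier_vec q" for x y
  proof -
    let ?f = "A *\<^sub>v x + B *\<^sub>v y"
    have f: "?f \<in> carrier_vec s" using A B x y by simp
    have xy: "x @\<^sub>v y \<in> carrier_vec (s + q)" using x y by simp
    have "nystrom A B F *\<^sub>v (x @\<^sub>v y) = append_rows A F *\<^sub>v (R *\<^sub>v (append_cols A B *\<^sub>v (x @\<^sub>v y)))"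
      unfolding nys using assoc_mult_mat_vec[OF mult_carrier_mat[OF P Rc] Q xy]
        assoc_mult_mat_vec[OF P Rc, of "append_cols A B *\<^sub>v (x @\<^sub>v y)"] Q xy by simp
    also have "\<dots> = append_rows A F *\<^sub>v (R *\<^sub>v ?f)"
      using append_cols_mult_vec[OF A(1) B x y] by simp
    also have "\<dots> = (A *\<^sub>v (R *\<^sub>v ?f)) @\<^sub>v (F *\<^sub>v (R *\<^sub>v ?f))"
      using Rc f by (intro mat_mult_append[OF A(1) F]) simp
    also have "A *\<^sub>v (R *\<^sub>v ?f) = ?f" using assoc_mult_mat_vec[OF A(1) Rc f] inv f by simp
    finally show ?thesis .
  qed
  moreover have "nystrom A B F \<in> carrier_mat (s + p) (s + q)"
    unfolding nys using P Q Rc by (intro mult_carrier_mat) auto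
  ultimately show thesis using that Rc inv by blast
qed

section \<open>The error bound\<close>

theorem theorem5p12:
  fixes M A B F C G G\<^sub>A G\<^sub>B S S\<^sub>A S\<^sub>B A\<^sub>l\<^sub>g B\<^sub>l\<^sub>g F\<^sub>l\<^sub>g C\<^sub>l\<^sub>g :: "real mat"
    and u v :: "nat \<Rightarrow> real vec"
    and m n s :: nat
    and e\<^sub>s \<beta> \<gamma> :: real
  assumes M_dim: "M \<in> carrier_mat m n"
    and s_range: "1 \<le> s" "s \<le> min m n"
    and M_blocks: "M = four_block_mat A B F C"
      "A \<in> carrier_mat s s" "B \<in> carrier_mat s (n - s)"
      "F \<in> carrier_mat (m - s) s" "C \<in> carrier_mat (m - s) (n - s)"
    and G_blocks: "G = append_rows G\<^sub>A G\<^sub>B"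
      "G\<^sub>A \<in> carrier_mat s s" "G\<^sub>B \<in> carrier_mat (m - s) s"
    and S_blocks: "S = append_cols S\<^sub>A S\<^sub>B"
      "S\<^sub>A \<in> carrier_mat s s" "S\<^sub>B \<in> carrier_mat s (n - s)"
    and approx: "spectral_norm (M - G * S) \<le> e\<^sub>s"
    and \<beta>_ge: "\<beta> \<ge> 1" and \<gamma>_ge: "\<gamma> \<ge> 1"
    and GS_pos: "singular_value (G * S) s > 0"
    and GS_factor: "singular_value G s * singular_value S s = singular_value (G * S) s / \<gamma>"
    and GA_lower: "singular_value G\<^sub>A s \<ge> singular_value G s / \<beta>"
    and SA_lower: "singular_value S\<^sub>A s \<ge> singular_value S s / \<beta>"
    and es_less: "e\<^sub>s < (singular_value M s - e\<^sub>s) / (\<beta>\<^sup>2 * \<gamma>)"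
    and gap: "singular_value M (s + 1) < (singular_value M s - e\<^sub>s) / (\<beta>\<^sup>2 * \<gamma>) - e\<^sub>s"
    and svd: "is_svd M u v"
    and lg_blocks: "split_block (svd_sum M u v s) s s = (A\<^sub>l\<^sub>g, B\<^sub>l\<^sub>g, F\<^sub>l\<^sub>g, C\<^sub>l\<^sub>g)"
    and nonsingular: "invertible_mat A" "invertible_mat A\<^sub>l\<^sub>g"
  shows "spectral_norm (M - nystrom A B F)
    \<le> singular_value M (s + 1) * \<beta>\<^sup>2 * \<gamma> / (singular_value M s - (1 + \<beta>\<^sup>2 * \<gamma>) * e\<^sub>s) *
      ((singular_value M 1)\<^sup>2 * \<beta>\<^sup>2 * \<gamma>
         / (singular_value M s - (1 + \<beta>\<^sup>2 * \<gamma>) * e\<^sub>s - singular_value M (s + 1) * \<beta>\<^sup>2 * \<gamma>)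
       + 2 * singular_value M 1 + singular_value M (s + 1))"
proof -
  define p where "p = m - s"
  define q where "q = n - s"
  have m: "m = s + p" and n: "n = s + q" using s_range by (auto simp: p_def q_def)
  note A = M_blocks(2) and B = M_blocks(3)[folded q_def] and F = M_blocks(4)[folded p_def]
    and C = M_blocks(5)[folded p_def q_def]
  note GB = G_blocks(3)[folded p_def] and SB = S_blocks(3)[folded q_def]
  note blocks = A B F C
  have M: "M \<in> carrier_mat m n" by fact
  have mn1: "1 \<le> min m n" using s_range by linarith
  define \<sigma>1 where "\<sigma>1 = singular_value M 1"
  define \<sigma> where "\<sigma> = singular_value M s"
  define t where "t = singular_value M (s + 1)"
  define K where "K = \<beta>\<^sup>2 * \<gamma>"
  define d where "d = (\<sigma> - e\<^sub>s) / K - e\<^sub>s"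
  define d' where "d' = d - t"
  have K: "K \<ge> 1" unfolding K_def
    using mult_mono[of 1 "\<beta>\<^sup>2" 1 \<gamma>] one_le_power[OF \<beta>_ge, of 2] \<gamma>_ge by simp
  have t0: "t \<ge> 0" and \<sigma>1: "\<sigma>1 \<ge> 0" by (auto simp: t_def \<sigma>1_def singular_value_nonneg)
  \<comment> \<open>The gap assumption says exactly that \<open>d'\<close> is positive.\<close>
  have d': "d' > 0" using gap by (simp add: d'_def d_def t_def \<sigma>_def K_def)
  then have d: "d > 0" using t0 by (simp add: d'_def)
  have M_le: "vec_2norm (M *\<^sub>v z) \<le> \<sigma>1 * vec_2norm z" if "z \<in> carrier_vec (s + q)" for z
    unfolding \<sigma>1_def using that n by (intro norm_mult_le_singular_value_1[OF M mn1]) simp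
  have M_zero: "M *\<^sub>v (x @\<^sub>v 0\<^sub>v q) = A *\<^sub>v x @\<^sub>v F *\<^sub>v x" if x: "x \<in> carrier_vec s" for x
    unfolding M_blocks(1) using four_block_mat_mult_vec[OF blocks x, of "0\<^sub>v q"] blocks x
    by (simp add: mult_mat_zero_vec)
  have norm_zero: "vec_2norm (x @\<^sub>v 0\<^sub>v q) = vec_2norm x" for x
    using vec_2norm_append_sq[of x "0\<^sub>v q"] by (simp add: vec_2norm_sq[of "0\<^sub>v q"])

  \<comment> \<open>Lower bound for \<open>A\<close> from the factorization
    \<open>G * S\<close>\<close>
  have G: "G \<in> carrier_mat m s" using G_blocks(1,2) GB m by simp
  have S: "S \<in> carrier_mat s n"
    unfolding S_blocks(1) append_cols_def n
    using four_block_carrier_mat[of S\<^sub>A s s "0\<^sub>m 0 q" 0 q S\<^sub>B "0\<^sub>m 0 s"] S_blocks(2) SB by simp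
  have GS: "G * S \<in> carrier_mat m n" using G S by simp
  have MGS: "M - G * S \<in> carrier_mat m n" using GS by (rule minus_carrier_mat)
  have e_le: "vec_2norm ((M - G * S) *\<^sub>v z) \<le> e\<^sub>s * vec_2norm z" if z: "z \<in> carrier_vec n" for z
    using norm_mult_le_spectral_norm[OF MGS mn1 z] mult_right_mono[OF approx vec_2norm_nonneg[of z]]
    by linarith
  have \<sigma>_GS: "\<sigma> \<le> singular_value (G * S) s + e\<^sub>s"
    unfolding \<sigma>_def using M GS s_range e_le by (rule singular_value_perturbation)
  \<comment> \<open>\<open>G\<^sub>A * S\<^sub>A\<close> is the top-left block of
    \<open>G * S\<close>. Its smallest singular value is at least the product of those of its
    factors, and on \<open>(x, 0)\<close> it deviates from \<open>A\<close> by at most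
    \<open>e\<^sub>s\<close>.\<close>
  have lowerA: "d * vec_2norm x \<le> vec_2norm (A *\<^sub>v x)" if x: "x \<in> carrier_vec s" for x
  proof -
    let ?SA = "singular_value S\<^sub>A s" and ?GA = "singular_value G\<^sub>A s"
    have Sx: "S\<^sub>A *\<^sub>v x \<in> carrier_vec s" using S_blocks(2) x by simp
    have xz: "x @\<^sub>v 0\<^sub>v q \<in> carrier_vec n" using x n by simp
    have "(\<sigma> - e\<^sub>s) / K \<le> singular_value (G * S) s / K" using \<sigma>_GS K by (intro divide_right_mono) auto
    \<comment> \<open>The factor \<open>\<gamma>\<close> of \<open>K\<close> is absorbed by the
      assumption on the product of singular values; each of the two factors \<open>\<beta>\<close>
      goes to one of the blocks \<open>G\<^sub>A\<close>, \<open>S\<^sub>A\<close>.\<close>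
    also have "\<dots> = (singular_value G s / \<beta>) * (singular_value S s / \<beta>)"
      using GS_factor by (simp add: K_def power2_eq_square field_simps)
    also have "\<dots> \<le> ?GA * ?SA"
      using GA_lower SA_lower \<beta>_ge singular_value_nonneg by (intro mult_mono) auto
    finally have "(\<sigma> - e\<^sub>s) / K * vec_2norm x \<le> ?GA * ?SA * vec_2norm x"
      by (intro mult_right_mono) auto
    also have "\<dots> \<le> ?GA * vec_2norm (S\<^sub>A *\<^sub>v x)"
      using norm_mult_ge_last_singular_value[OF S_blocks(2) s_range(1) order_refl x]
      by (simp add: mult.assoc mult_left_mono singular_value_nonneg)
    also have "\<dots> \<le> vec_2norm (G\<^sub>A *\<^sub>v (S\<^sub>A *\<^sub>v x))"
      by (rule norm_mult_ge_last_singular_value[OF G_blocks(2) s_range(1) order_refl Sx])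
    also have "\<dots> \<le> vec_2norm (A *\<^sub>v x) + vec_2norm (A *\<^sub>v x - G\<^sub>A *\<^sub>v (S\<^sub>A *\<^sub>v x))"
    proof -
      have "G\<^sub>A *\<^sub>v (S\<^sub>A *\<^sub>v x) = A *\<^sub>v x - (A *\<^sub>v x - G\<^sub>A *\<^sub>v (S\<^sub>A *\<^sub>v x))"
        using A G_blocks(2) x Sx by (intro eq_vecI) auto
      then show ?thesis
        using vec_2norm_diff_triangle[of "A *\<^sub>v x" s "A *\<^sub>v x - G\<^sub>A *\<^sub>v (S\<^sub>A *\<^sub>v x)"] A G_blocks(2) x Sx
        by simp
    qed
    also have "vec_2norm (A *\<^sub>v x - G\<^sub>A *\<^sub>v (S\<^sub>A *\<^sub>v x)) \<le> e\<^sub>s * vec_2norm x"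
    proof -
      have "S *\<^sub>v (x @\<^sub>v 0\<^sub>v q) = S\<^sub>A *\<^sub>v x"
        unfolding S_blocks(1) using append_cols_mult_vec[OF S_blocks(2) SB x, of "0\<^sub>v q"] SB Sx
        by (simp add: mult_mat_zero_vec)
      then have "(G * S) *\<^sub>v (x @\<^sub>v 0\<^sub>v q) = G *\<^sub>v (S\<^sub>A *\<^sub>v x)"
        using assoc_mult_mat_vec[OF G S xz] by simp
      also have "\<dots> = (G\<^sub>A *\<^sub>v (S\<^sub>A *\<^sub>v x)) @\<^sub>v (G\<^sub>B *\<^sub>v (S\<^sub>A *\<^sub>v x))"
        unfolding G_blocks(1) by (rule mat_mult_append[OF G_blocks(2) GB Sx])
      finally have "vec_2norm (A *\<^sub>v x - G\<^sub>A *\<^sub>v (S\<^sub>A *\<^sub>v x)) \<le> vec_2norm ((M - G * S) *\<^sub>v (x @\<^sub>v 0\<^sub>v q))"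
        using top_block_diff_le[OF M[unfolded m] GS[unfolded m] xz M_zero[OF x]] A F G_blocks(2) GB x Sx
        by simp
      also have "\<dots> \<le> e\<^sub>s * vec_2norm x" using e_le[OF xz] by (simp add: norm_zero)
      finally show ?thesis .
    qed
    finally show ?thesis by (simp add: d_def algebra_simps)
  qed

  \<comment> \<open>The truncated SVD and its top-left block\<close>
  define L where "L = svd_sum M u v s"
  have L: "L \<in> carrier_mat m n" using M by (simp add: L_def svd_sum_def)
  have "dim_row L = s + p" "dim_col L = s + q" using L m n by auto
  note Ls = split_block[OF lg_blocks[folded L_def] this]
  have L_le: "vec_2norm (L *\<^sub>v z) \<le> \<sigma>1 * vec_2norm z" if "z \<in> carrier_vec (s + q)" for z
    unfolding L_def \<sigma>1_def using that n by (intro svd_sum_norm_bound[OF M svd s_range(2)]) simp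
  have E_le: "vec_2norm (M *\<^sub>v z - L *\<^sub>v z) \<le> t * vec_2norm z" if "z \<in> carrier_vec n" for z
    unfolding L_def t_def using that by (rule svd_sum_error_bound[OF M svd s_range(2)])
  have v: "v i \<in> carrier_vec n" if "i \<in> {1..s}" for i
    using svd M that s_range(2) by (auto simp: is_svd_def Let_def orthonormal_family_def)
  have L_ker: "L *\<^sub>v z = 0\<^sub>v m" if z: "z \<in> carrier_vec n" and orth: "\<forall>i\<in>{1..s}. v i \<bullet> z = 0" for z
  proof -
    have "L *\<^sub>v z = vec_comb m {1..s} (\<lambda>i. singular_value M i * (v i \<bullet> z)) u"
      unfolding L_def using v by (rule svd_sum_mult_vec[OF M z])
    also have "\<dots> = 0\<^sub>v m" using orth by (intro eq_vecI) (auto simp: vec_comb_def)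
    finally show ?thesis .
  qed
  have L_mult: "L *\<^sub>v (x @\<^sub>v y) = (A\<^sub>l\<^sub>g *\<^sub>v x + B\<^sub>l\<^sub>g *\<^sub>v y) @\<^sub>v (F\<^sub>l\<^sub>g *\<^sub>v x + C\<^sub>l\<^sub>g *\<^sub>v y)"
    if "x \<in> carrier_vec s" "y \<in> carrier_vec q" for x y
    unfolding Ls(5) by (rule four_block_mat_mult_vec[OF Ls(1-4) that])
  have top_zero: "A\<^sub>l\<^sub>g *\<^sub>v x + B\<^sub>l\<^sub>g *\<^sub>v y = 0\<^sub>v s"
    if x: "x \<in> carrier_vec s" and y: "y \<in> carrier_vec q" and orth: "\<forall>i\<in>{1..s}. v i \<bullet> (x @\<^sub>v y) = 0" for x y
  proof -
    have eq: "(A\<^sub>l\<^sub>g *\<^sub>v x + B\<^sub>l\<^sub>g *\<^sub>v y) @\<^sub>v (F\<^sub>l\<^sub>g *\<^sub>v x + C\<^sub>l\<^sub>g *\<^sub>v y) = 0\<^sub>v m"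
      using L_ker[OF _ orth] L_mult[OF x y] x y n by simp
    show ?thesis
    proof (rule eq_vecI)
      fix i assume "i < dim_vec (0\<^sub>v s :: real vec)"
      then have i: "i < s" by simp
      show "(A\<^sub>l\<^sub>g *\<^sub>v x + B\<^sub>l\<^sub>g *\<^sub>v y) $ i = 0\<^sub>v s $ i"
        using arg_cong[OF eq, of "\<lambda>v. v $ i"] i m Ls(1-4) by simp
    qed (use Ls(1-4) in simp)
  qed
  have L_zero: "L *\<^sub>v (x @\<^sub>v 0\<^sub>v q) = A\<^sub>l\<^sub>g *\<^sub>v x @\<^sub>v F\<^sub>l\<^sub>g *\<^sub>v x" if x: "x \<in> carrier_vec s" for x
    using L_mult[OF x, of "0\<^sub>v q"] Ls(1-4) x by (simp add: mult_mat_zero_vec)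
  \<comment> \<open>On \<open>(x, 0)\<close> the top parts of the images under \<open>M\<close> and
    \<open>L\<close> differ by at most \<open>t\<close> times the norm of \<open>x\<close>, so the
    lower bound for \<open>A\<close> loses \<open>t\<close>.\<close>
  have lowerLg: "d' * vec_2norm x \<le> vec_2norm (A\<^sub>l\<^sub>g *\<^sub>v x)" if x: "x \<in> carrier_vec s" for x
  proof -
    have xz: "x @\<^sub>v 0\<^sub>v q \<in> carrier_vec n" using x n by simp
    have "vec_2norm (A *\<^sub>v x) \<le> vec_2norm (A\<^sub>l\<^sub>g *\<^sub>v x) + vec_2norm (A *\<^sub>v x - A\<^sub>l\<^sub>g *\<^sub>v x)"
      using A Ls(1) x by (intro vec_2norm_le_plus_diff[of _ s]) auto
    also have "vec_2norm (A *\<^sub>v x - A\<^sub>l\<^sub>g *\<^sub>v x) \<le> vec_2norm ((M - L) *\<^sub>v (x @\<^sub>v 0\<^sub>v q))"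
      using top_block_diff_le[OF M[unfolded m] L[unfolded m] xz M_zero[OF x] L_zero[OF x]] A F Ls x
      by simp
    also have "\<dots> \<le> t * vec_2norm x"
      using E_le[OF xz] by (simp add: norm_zero minus_mult_distrib_mat_vec[OF M L xz])
    finally show ?thesis using lowerA[OF x] by (simp add: d'_def algebra_simps)
  qed
  \<comment> \<open>Comparing the lower bound for \<open>A\<close> with the upper bound for
    \<open>M\<close> on one unit vector, which exists as \<open>s \<ge> 1\<close>.\<close>
  have d_\<sigma>1: "d \<le> \<sigma>1"
  proof -
    let ?x = "unit_vec s 0 :: real vec"
    have "?x \<bullet> ?x = 1" using s_range(1) by simp
    then have x1: "vec_2norm ?x = 1" by (simp add: vec_2norm_def)
    have "d * vec_2norm ?x \<le> vec_2norm (A *\<^sub>v ?x)" by (rule lowerA) simp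
    also have "\<dots> \<le> vec_2norm (M *\<^sub>v (?x @\<^sub>v 0\<^sub>v q))" by (simp add: M_zero vec_2norm_append_le)
    also have "\<dots> \<le> \<sigma>1 * vec_2norm ?x" using M_le[of "?x @\<^sub>v 0\<^sub>v q"] by (simp add: norm_zero)
    finally show ?thesis by (simp add: x1)
  qed
  have d'_\<sigma>1: "d' \<le> \<sigma>1" using d_\<sigma>1 t0 by (simp add: d'_def)

  \<comment> \<open>Pointwise bound on the residual\<close>
  obtain R where R: "R \<in> carrier_mat s s" "A * R = 1\<^sub>m s" "R * A = 1\<^sub>m s"
    and N: "nystrom A B F \<in> carrier_mat (s + p) (s + q)"
    and N_mult: "\<And>x y. x \<in> carrier_vec s \<Longrightarrow> y \<in> carrier_vec q \<Longrightarrow> nystrom A B F *\<^sub>v (x @\<^sub>v y)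
       = (A *\<^sub>v x + B *\<^sub>v y) @\<^sub>v (F *\<^sub>v (R *\<^sub>v (A *\<^sub>v x + B *\<^sub>v y)))"
    using nystrom_mult_vec[OF A nonsingular(1) B F] by blast
  have key: "vec_2norm ((M - nystrom A B F) *\<^sub>v z0) \<le> \<sigma>1\<^sup>2 * t / (d * d') * vec_2norm z0"
    if z0: "z0 \<in> carrier_vec n" for z0
  proof -
    obtain x0 y where x0: "x0 \<in> carrier_vec s" and y: "y \<in> carrier_vec q" and z0_eq: "z0 = x0 @\<^sub>v y"
      using vec_first_last_append[of z0 s q] z0 n by (metis vec_first_carrier vec_last_carrier)
    \<comment> \<open>The upper part \<open>x0\<close> is exchanged for one that makes
      \<open>(x, y)\<close> orthogonal to the first \<open>s\<close> right singular vectors. The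
      system is solvable: if \<open>(x, 0)\<close> is orthogonal to them, then
      \<open>A\<^sub>l\<^sub>g\<close> maps \<open>x\<close> to 0, so \<open>x = 0\<close> by
      \<open>lowerLg\<close>.\<close>
    obtain x where x: "x \<in> carrier_vec s" and orth: "\<forall>i\<in>{1..s}. v i \<bullet> (x @\<^sub>v y) = 0"
    proof (rule orthogonal_completion[OF v[unfolded n] y])
      fix x assume x: "x \<in> carrier_vec s" and o: "\<forall>i\<in>{1..s}. v i \<bullet> (x @\<^sub>v 0\<^sub>v q) = 0"
      have "A\<^sub>l\<^sub>g *\<^sub>v x = 0\<^sub>v s"
        using top_zero[OF x _ o] Ls(1,2) x by (simp add: mult_mat_zero_vec)
      then have "d' * vec_2norm x \<le> 0" using lowerLg[OF x] by (simp add: vec_2norm_def)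
      then have "vec_2norm x = 0" using d' vec_2norm_nonneg[of x] by (simp add: mult_le_0_iff)
      then show "x = 0\<^sub>v s" using x by (simp add: vec_2norm_eq_0_iff)
    qed auto
    define z where "z = x @\<^sub>v y"
    have z: "z \<in> carrier_vec n" using x y n by (simp add: z_def)
    define f g where "f = A *\<^sub>v x + B *\<^sub>v y" and "g = F *\<^sub>v x + C *\<^sub>v y"
    define w where "w = R *\<^sub>v f"
    have fg: "f \<in> carrier_vec s" "g \<in> carrier_vec p" "w \<in> carrier_vec s"
      using blocks x y R by (auto simp: f_def g_def w_def)
    have Aw: "A *\<^sub>v w = f" unfolding w_def using assoc_mult_mat_vec[OF A R(1) fg(1)] R fg by simp
    have Mz: "M *\<^sub>v z = f @\<^sub>v g"
      unfolding z_def M_blocks(1) f_def g_def by (rule four_block_mat_mult_vec[OF blocks x y])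
    \<comment> \<open>For any upper part, the lower residual equals the Schur complement
      \<open>C y - F h\<close> with \<open>h = R (B y)\<close>. It is therefore the same for
      \<open>x0\<close> and \<open>x\<close>.\<close>
    have "(M - nystrom A B F) *\<^sub>v z0 = 0\<^sub>v s @\<^sub>v (g - F *\<^sub>v w)"
    proof -
      define h where "h = R *\<^sub>v (B *\<^sub>v y)"
      have h: "h \<in> carrier_vec s" using R B y by (simp add: h_def)
      have shift: "R *\<^sub>v (A *\<^sub>v x' + B *\<^sub>v y) = x' + h" if x': "x' \<in> carrier_vec s" for x'
      proof -
        have "R *\<^sub>v (A *\<^sub>v x' + B *\<^sub>v y) = R *\<^sub>v (A *\<^sub>v x') + h"
          unfolding h_def using A B x' y by (intro mult_add_distrib_mat_vec[OF R(1)]) auto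
        also have "R *\<^sub>v (A *\<^sub>v x') = x'"
          using assoc_mult_mat_vec[OF R(1) A x'] R x' by simp
        finally show ?thesis .
      qed
      have schur: "(F *\<^sub>v x' + C *\<^sub>v y) - F *\<^sub>v (x' + h) = C *\<^sub>v y - F *\<^sub>v h"
        if x': "x' \<in> carrier_vec s" for x'
        unfolding mult_add_distrib_mat_vec[OF F x' h] using F C y h by (intro eq_vecI) auto
      have "(M - nystrom A B F) *\<^sub>v z0 = M *\<^sub>v z0 - nystrom A B F *\<^sub>v z0"
        using minus_mult_distrib_mat_vec[OF M _ z0] N m n by simp
      also have "M *\<^sub>v z0 = (A *\<^sub>v x0 + B *\<^sub>v y) @\<^sub>v (F *\<^sub>v x0 + C *\<^sub>v y)"
        unfolding z0_eq M_blocks(1) by (rule four_block_mat_mult_vec[OF blocks x0 y])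
      also have "nystrom A B F *\<^sub>v z0 = (A *\<^sub>v x0 + B *\<^sub>v y) @\<^sub>v (F *\<^sub>v (x0 + h))"
        unfolding z0_eq N_mult[OF x0 y] shift[OF x0] ..
      also have "((A *\<^sub>v x0 + B *\<^sub>v y) @\<^sub>v (F *\<^sub>v x0 + C *\<^sub>v y)) - ((A *\<^sub>v x0 + B *\<^sub>v y) @\<^sub>v (F *\<^sub>v (x0 + h)))
          = ((A *\<^sub>v x0 + B *\<^sub>v y) - (A *\<^sub>v x0 + B *\<^sub>v y)) @\<^sub>v ((F *\<^sub>v x0 + C *\<^sub>v y) - F *\<^sub>v (x0 + h))"
        using blocks x0 y h by (intro append_vec_diff[of _ s _ _ p]) auto
      also have "(A *\<^sub>v x0 + B *\<^sub>v y) - (A *\<^sub>v x0 + B *\<^sub>v y) = 0\<^sub>v s"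
        using A B x0 y by (intro eq_vecI) auto
      also have "(F *\<^sub>v x0 + C *\<^sub>v y) - F *\<^sub>v (x0 + h) = g - F *\<^sub>v w"
        unfolding schur[OF x0] unfolding g_def w_def f_def shift[OF x] schur[OF x] ..
      finally show ?thesis .
    qed
    then have "vec_2norm ((M - nystrom A B F) *\<^sub>v z0) = vec_2norm (g - F *\<^sub>v w)"
      using vec_2norm_append_sq[of "0\<^sub>v s" "g - F *\<^sub>v w"] by (simp add: vec_2norm_sq[of "0\<^sub>v s"])
    then have "d * vec_2norm ((M - nystrom A B F) *\<^sub>v z0) \<le> \<sigma>1 * vec_2norm (M *\<^sub>v z)"
      using schur_residual_bound[OF blocks fg(3,2) M_le[unfolded M_blocks(1)] lowerA[OF fg(3)] _ d_\<sigma>1] d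
      by (simp add: Mz Aw)
    \<comment> \<open>As \<open>L\<close> annihilates \<open>z\<close>, only the tail of the SVD
      acts on it, which brings in the factor \<open>t\<close>.\<close>
    also have "M *\<^sub>v z = M *\<^sub>v z - L *\<^sub>v z"
      using L_ker[OF z] orth M z by (simp add: z_def)
    also have "\<sigma>1 * vec_2norm (M *\<^sub>v z - L *\<^sub>v z) \<le> \<sigma>1 * (t * vec_2norm z)"
      using E_le[OF z] \<sigma>1 by (intro mult_left_mono)
    finally have "d' * (d * vec_2norm ((M - nystrom A B F) *\<^sub>v z0)) \<le> d' * (\<sigma>1 * (t * vec_2norm z))"
      using d' by (intro mult_left_mono) auto
    also have "\<dots> = \<sigma>1 * t * (d' * vec_2norm z)" by simp
    \<comment> \<open>\<open>kernel_vector_bound\<close> is applied to the blocks of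
      \<open>L\<close>: the top part of the image of \<open>z\<close> vanishes, and the upper bound
      \<open>\<sigma>1\<close> for \<open>M\<close> also holds for \<open>L\<close>.\<close>
    also have "\<dots> \<le> \<sigma>1 * t * (\<sigma>1 * vec_2norm y)"
      unfolding z_def
      using kernel_vector_bound[OF Ls(1-4) x y L_le[unfolded Ls(5)] lowerLg[OF x] _ d'_\<sigma>1 top_zero[OF x y orth]]
        d' \<sigma>1 t0 by (intro mult_left_mono) auto
    also have "\<dots> \<le> \<sigma>1 * t * (\<sigma>1 * vec_2norm z0)"
      unfolding z0_eq using \<sigma>1 t0 by (intro mult_left_mono vec_2norm_append_le) auto
    finally show ?thesis using d d' by (simp add: field_simps power2_eq_square)
  qed

  \<comment> \<open>From the pointwise bound to the stated form\<close>
  have "M - nystrom A B F \<in> carrier_mat m n" using N m n by (simp add: minus_carrier_mat)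
  then have "spectral_norm (M - nystrom A B F) \<le> \<sigma>1\<^sup>2 * t / (d * d')"
    using key d d' t0 by (intro spectral_norm_le) auto
  \<comment> \<open>The summands \<open>2 * \<sigma>1 + t\<close> are nonnegative, so adding them
    only enlarges the bound. Afterwards both fractions are expanded by \<open>K\<close>.\<close>
  also have "\<sigma>1\<^sup>2 * t / (d * d') \<le> t / d * (\<sigma>1\<^sup>2 / d' + 2 * \<sigma>1 + t)"
  proof -
    have "t / d * (\<sigma>1\<^sup>2 / d') \<le> t / d * (\<sigma>1\<^sup>2 / d' + 2 * \<sigma>1 + t)"
      using t0 d \<sigma>1 by (intro mult_left_mono) auto
    then show ?thesis by (simp add: field_simps)
  qed
  also have "t / d = t * K / (\<sigma> - (1 + K) * e\<^sub>s)"
  proof -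
    have "d = (\<sigma> - (1 + K) * e\<^sub>s) / K" using K by (simp add: d_def field_simps)
    then show ?thesis by simp
  qed
  also have "\<sigma>1\<^sup>2 / d' = \<sigma>1\<^sup>2 * K / (\<sigma> - (1 + K) * e\<^sub>s - t * K)"
  proof -
    have "d' = (\<sigma> - (1 + K) * e\<^sub>s - t * K) / K" using K by (simp add: d'_def d_def field_simps)
    then show ?thesis by simp
  qed
  finally show ?thesis by (simp add: K_def \<sigma>1_def \<sigma>_def t_def mult.assoc)
qed

end
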